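(* The set $\mathcal O=\mathcal Q\cup S_\gamma^G$ is a $(q+1)$-ovoid of $\mathcal W(5,q)$, i.e. every generator (totally isotropic plane) of $\mathcal W(5,q)$ contains exactly $q+1$ points of $\mathcal O$. It has $(q+1)(q^3+1)$ points.
   Context: Let $q$ be an even prime power and $\mathrm{PG}(5,q^2)$ have homogeneous coordinates $(X_1,\dots,X_6)$, points written as column vectors. Let $\Sigma$ be the set of points having a coordinate vector $(\alpha,\alpha^q,\delta_0,\beta,\beta^q,\delta_1)$ with $\alpha,\beta\in\mathbb F_{q^2}$, $\delta_0,\delta_1\in\mathbb F_q$ (a Baer subgeometry $\cong\mathrm{PG}(5,q)$). Let $\mathcal Q=\Sigma\cap\{X_6=0,\ X_3^2+X_1X_5+X_2X_4=0\}=\{(\alpha,\alpha^q,\sqrt{\alpha\beta^q+\alpha^q\beta},\beta,\beta^q,0):(\alpha,\beta)\ne(0,0)\}$. Fix $\omega\in\mathbb F_{q^2}\setminus\mathbb F_q$ with $\omega+\omega^q=1$ and let $h(X,Y)=\omega X_1Y_4^q+\omega^qX_1Y_6^q+\omega^qX_2Y_5^q+\omega X_2Y_6^q+X_3Y_6^q+\omega^qX_4Y_1^q+\omega X_5Y_2^q+\omega X_6Y_1^q+\omega^qX_6Y_2^q+X_6Y_3^q$. Restricted to $\Sigma$, $P\perp R\iff h(P,R)=0$ defines a symplectic polarity $\perp$ of $\Sigma\cong\mathrm{PG}(5,q)$; $\mathcal W(5,q)$ is the associated symplectic polar space. For $a,b,c,d\in\mathbb F_{q^2}$ with $ad+bc=1$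 let $M_{a,b,c,d}$ be the $6\times6$ matrix with rows $(a^2,0,0,0,c^2,\tfrac{c(a+c\omega^q)}{\omega})$, $(0,a^{2q},0,c^{2q},0,\tfrac{c^q(a^q+c^q\omega)}{\omega^q})$, $(ab,a^qb^q,1,c^qd^q,cd,\tfrac{d(a+c\omega^q)}{\omega}+\tfrac{d^q(a^q+c^q\omega)}{\omega^q}+\tfrac{1}{\omega^{q+1}})$, $(0,b^{2q},0,d^{2q},0,\tfrac{d^q(b^q+d^q\omega)+\omega}{\omega^q})$, $(b^2,0,0,0,d^2,\tfrac{d(b+d\omega^q)+\omega^q}{\omega})$, $(0,0,0,0,0,1)$, and let $G\cong\mathrm{PSL}(2,q^2)$ be the group of projectivities $X\mapsto M_{a,b,c,d}X$. Fix $\gamma\in\mathbb F_{q^2}$ with $X^2+X+\gamma$ irreducible over $\mathbb F_{q^2}$, let $S_\gamma=\left(\frac{\gamma}{\omega},\frac{\gamma^q}{\omega^q},\frac{\omega^q\gamma}{\omega}+\frac{\omega\gamma^q}{\omega^q},1,1,1\right)$ and $S_\gamma^G$ its $G$-orbit. An $m$-ovoid of $\mathcal W(5,q)$ is a set of points meeting every generator in exactly $m$ points. *)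

theory Defs
  imports "HOL-Computational_Algebra.Polynomial"
begin

text \<open>Vectors of PG(5,q^2) are functions nat => 'a supported on the coordinate
indices 1..6 (X_1,...,X_6).  Here 'a plays the role of GF(q^2).\<close>

definition mk6 :: "'a::zero \<Rightarrow> 'a \<Rightarrow> 'a \<Rightarrow> 'a \<Rightarrow> 'a \<Rightarrow> 'a \<Rightarrow> nat \<Rightarrow> 'a" where
  "mk6 x1 x2 x3 x4 x5 x6 = (\<lambda>i. if i = 1 then x1 else if i = 2 then x2 else
     if i = 3 then x3 else if i = 4 then x4 else if i = 5 then x5 else if i = 6 then x6 else 0)"

definition subF :: "nat \<Rightarrow> 'a::field set" where
  "subF q = {x. x ^ q = x}"

definition proj_pt :: "(nat \<Rightarrow> 'a::field) \<Rightarrow> (nat \<Rightarrow> 'a) set" where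
  "proj_pt v = {(\<lambda>i. c * v i) | c. c \<noteq> 0}"

definition sigma_vecs :: "nat \<Rightarrow> (nat \<Rightarrow> 'a::field) set" where
  "sigma_vecs q = {mk6 \<alpha> (\<alpha> ^ q) \<delta>0 \<beta> (\<beta> ^ q) \<delta>1 | \<alpha> \<beta> \<delta>0 \<delta>1.
      \<delta>0 \<in> subF q \<and> \<delta>1 \<in> subF q}"

definition Sigma_pts :: "nat \<Rightarrow> (nat \<Rightarrow> 'a::field) set set" where
  "Sigma_pts q = {proj_pt v | v. v \<in> sigma_vecs q \<and> v \<noteq> (\<lambda>i. 0)}"

definition Q_pts :: "nat \<Rightarrow> (nat \<Rightarrow> 'a::field) set set" where
  "Q_pts q = {P \<in> Sigma_pts q. \<exists>v\<in>P. v 6 = 0 \<and> (v 3)\<^sup>2 + v 1 * v 5 + v 2 * v 4 = 0}"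

definition herm :: "nat \<Rightarrow> 'a::field \<Rightarrow> (nat \<Rightarrow> 'a) \<Rightarrow> (nat \<Rightarrow> 'a) \<Rightarrow> 'a" where
  "herm q \<omega> X Y =
     \<omega> * X 1 * (Y 4) ^ q + \<omega> ^ q * X 1 * (Y 6) ^ q + \<omega> ^ q * X 2 * (Y 5) ^ q
     + \<omega> * X 2 * (Y 6) ^ q + X 3 * (Y 6) ^ q + \<omega> ^ q * X 4 * (Y 1) ^ q
     + \<omega> * X 5 * (Y 2) ^ q + \<omega> * X 6 * (Y 1) ^ q + \<omega> ^ q * X 6 * (Y 2) ^ q
     + X 6 * (Y 3) ^ q"

definition fq_span :: "nat \<Rightarrow> (nat \<Rightarrow> 'a::field) \<Rightarrow> (nat \<Rightarrow> 'a) \<Rightarrow> (nat \<Rightarrow> 'a) \<Rightarrow> (nat \<Rightarrow> 'a) set" where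
  "fq_span q u1 u2 u3 = {(\<lambda>i. a1 * u1 i + a2 * u2 i + a3 * u3 i) | a1 a2 a3.
      a1 \<in> subF q \<and> a2 \<in> subF q \<and> a3 \<in> subF q}"

definition fq_indep :: "nat \<Rightarrow> (nat \<Rightarrow> 'a::field) \<Rightarrow> (nat \<Rightarrow> 'a) \<Rightarrow> (nat \<Rightarrow> 'a) \<Rightarrow> bool" where
  "fq_indep q u1 u2 u3 \<longleftrightarrow> (\<forall>a1 a2 a3. a1 \<in> subF q \<and> a2 \<in> subF q \<and> a3 \<in> subF q \<and>
      (\<lambda>i. a1 * u1 i + a2 * u2 i + a3 * u3 i) = (\<lambda>i. 0) \<longrightarrow> a1 = 0 \<and> a2 = 0 \<and> a3 = 0)"

text \<open>Generators of W(5,q): planes of Sigma = PG(5,q) (spanned over GF(q) by three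
independent Sigma-vectors) that are totally isotropic w.r.t. h; a generator is given as
its set of points.\<close>
definition generators :: "nat \<Rightarrow> 'a::field \<Rightarrow> (nat \<Rightarrow> 'a) set set set" where
  "generators q \<omega> = {{proj_pt w | w. w \<in> fq_span q u1 u2 u3 \<and> w \<noteq> (\<lambda>i. 0)} | u1 u2 u3.
      u1 \<in> sigma_vecs q \<and> u2 \<in> sigma_vecs q \<and> u3 \<in> sigma_vecs q \<and> fq_indep q u1 u2 u3 \<and>
      (\<forall>x\<in>fq_span q u1 u2 u3. \<forall>y\<in>fq_span q u1 u2 u3. herm q \<omega> x y = 0)}"

definition is_m_ovoid :: "nat \<Rightarrow> 'a::field \<Rightarrow> (nat \<Rightarrow> 'a) set set \<Rightarrow> nat \<Rightarrow> bool" where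
  "is_m_ovoid q \<omega> S m \<longleftrightarrow> S \<subseteq> Sigma_pts q \<and> (\<forall>g\<in>generators q \<omega>. card (g \<inter> S) = m)"

definition Mmat :: "nat \<Rightarrow> 'a::field \<Rightarrow> 'a \<Rightarrow> 'a \<Rightarrow> 'a \<Rightarrow> 'a \<Rightarrow> nat \<Rightarrow> nat \<Rightarrow> 'a" where
  "Mmat q \<omega> a b c d i =
    (if i = 1 then mk6 (a\<^sup>2) 0 0 0 (c\<^sup>2) (c * (a + c * \<omega> ^ q) / \<omega>)
     else if i = 2 then mk6 0 (a ^ (2 * q)) 0 (c ^ (2 * q)) 0 (c ^ q * (a ^ q + c ^ q * \<omega>) / \<omega> ^ q)
     else if i = 3 then mk6 (a * b) (a ^ q * b ^ q) 1 (c ^ q * d ^ q) (c * d)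
        (d * (a + c * \<omega> ^ q) / \<omega> + d ^ q * (a ^ q + c ^ q * \<omega>) / \<omega> ^ q + 1 / \<omega> ^ (q + 1))
     else if i = 4 then mk6 0 (b ^ (2 * q)) 0 (d ^ (2 * q)) 0 ((d ^ q * (b ^ q + d ^ q * \<omega>) + \<omega>) / \<omega> ^ q)
     else if i = 5 then mk6 (b\<^sup>2) 0 0 0 (d\<^sup>2) ((d * (b + d * \<omega> ^ q) + \<omega> ^ q) / \<omega>)
     else if i = 6 then mk6 0 0 0 0 0 1
     else (\<lambda>j. 0))"

definition mat_app :: "(nat \<Rightarrow> nat \<Rightarrow> 'a::field) \<Rightarrow> (nat \<Rightarrow> 'a) \<Rightarrow> nat \<Rightarrow> 'a" where
  "mat_app M x = (\<lambda>i. if i \<in> {1..6} then (\<Sum>j = 1..6. M i j * x j) else 0)"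

definition G_orbit :: "nat \<Rightarrow> 'a::field \<Rightarrow> (nat \<Rightarrow> 'a) \<Rightarrow> (nat \<Rightarrow> 'a) set set" where
  "G_orbit q \<omega> v = {proj_pt (mat_app (Mmat q \<omega> a b c d) v) | a b c d. a * d + b * c = 1}"

definition S_gamma :: "nat \<Rightarrow> 'a::field \<Rightarrow> 'a \<Rightarrow> nat \<Rightarrow> 'a" where
  "S_gamma q \<omega> \<gamma> = mk6 (\<gamma> / \<omega>) (\<gamma> ^ q / \<omega> ^ q)
      (\<omega> ^ q * \<gamma> / \<omega> + \<omega> * \<gamma> ^ q / \<omega> ^ q) 1 1 1"

definition ovoid_O :: "nat \<Rightarrow> 'a::field \<Rightarrow> 'a \<Rightarrow> (nat \<Rightarrow> 'a) set set" where
  "ovoid_O q \<omega> \<gamma> = Q_pts q \<union> G_orbit q \<omega> (S_gamma q \<omega> \<gamma>)"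

end

theory Submission
  imports Defs "HOL-Number_Theory.Residues" "HOL-Library.Product_Plus"
begin

text \<open>
Write \<open>\<mu> = 1/\<omega>\<close>, \<open>\<nu> = 1/\<omega>^q\<close> and \<open>tr\<close> for the trace to \<open>GF(q)\<close>.  In the coordinates
\<open>A = \<omega> X1\<close>, \<open>B = \<omega> X5 + \<omega>^q X6\<close>, \<open>s = X3 + \<kappa> X6\<close>, \<open>d = X6\<close> of the Baer subgeometry the symplectic form is
\<open>tr (\<mu> (A B' + A' B)) + s d' + s' d\<close>, and the two parts of the ovoid merge into one set, given by
\<open>A B = C^2 + d C + d^2 \<gamma>\<close> and \<open>tr (\<mu> C) = s\<close> for some \<open>C\<close>.

On a totally isotropic plane \<open>W\<close> the polar forms of the quadratic maps involved take values in
\<open>GF(q) \<nu>\<close>; so, in the basis \<open>\<nu>, \<nu>^2\<close> of \<open>GF(q^2)\<close>, the second component of the equation is additive and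
can be solved for the free parameter in \<open>C\<close>.  What remains is a conic of \<open>W\<close>.  Irreducibility of
\<open>X^2 + X + \<gamma>\<close> shows that this conic has a nucleus \<open>r\<close> off the conic: every line of \<open>W\<close> through \<open>r\<close>
carries exactly one point of it, hence it has \<open>q + 1\<close> points.
\<close>

section \<open>Coordinate vectors and the irreducible quadratic\<close>

lemma mk6_simps [simp]:
  "mk6 x1 x2 x3 x4 x5 x6 (Suc 0) = x1" "mk6 x1 x2 x3 x4 x5 x6 2 = x2" "mk6 x1 x2 x3 x4 x5 x6 3 = x3"
  "mk6 x1 x2 x3 x4 x5 x6 4 = x4" "mk6 x1 x2 x3 x4 x5 x6 5 = x5" "mk6 x1 x2 x3 x4 x5 x6 6 = x6"
  by (simp_all add: mk6_def)

lemma mk6_eq_iff: "mk6 x1 x2 x3 x4 x5 x6 = mk6 y1 y2 y3 y4 y5 y6 \<longleftrightarrow>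
    x1 = y1 \<and> x2 = y2 \<and> x3 = y3 \<and> x4 = y4 \<and> x5 = y5 \<and> x6 = y6"
  (is "?x = ?y \<longleftrightarrow> _")
proof
  assume xy: "?x = ?y"
  have "?x i = ?y i" for i by (simp only: xy)
  from this[of 1] this[of 2] this[of 3] this[of 4] this[of 5] this[of 6]
  show "x1 = y1 \<and> x2 = y2 \<and> x3 = y3 \<and> x4 = y4 \<and> x5 = y5 \<and> x6 = y6" by simp
qed simp

lemma mk6_0: "(\<lambda>i. 0) = mk6 0 0 0 0 0 0"
  by (auto simp: mk6_def)

lemma mk6_add: "(\<lambda>i. mk6 x1 x2 x3 x4 x5 x6 i + mk6 y1 y2 y3 y4 y5 y6 i ::
    'a::monoid_add) = mk6 (x1 + y1) (x2 + y2) (x3 + y3) (x4 + y4) (x5 + y5) (x6 + y6)"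
  by (auto simp: mk6_def)

lemma mk6_scale: "(\<lambda>i. c * mk6 x1 x2 x3 x4 x5 x6 i :: 'a::mult_zero)
    = mk6 (c * x1) (c * x2) (c * x3) (c * x4) (c * x5) (c * x6)"
  by (auto simp: mk6_def)

text \<open>A root splits off a linear factor; the cofactor then has degree 1 as well, and neither
  factor is a unit.\<close>

lemma irreducible_quadratic_no_root:
  fixes \<gamma> C :: "'a::field"
  assumes "irreducible [:\<gamma>, 1, 1:]"
  shows "C\<^sup>2 + C + \<gamma> \<noteq> 0"
proof
  assume "C\<^sup>2 + C + \<gamma> = 0"
  then have "poly [:\<gamma>, 1, 1:] C = 0" by (simp add: algebra_simps power2_eq_square)
  then obtain k where k: "[:\<gamma>, 1, 1:] = [:- C, 1:] * k" unfolding poly_eq_0_iff_dvd by (auto simp: dvd_def)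
  then have "k \<noteq> 0" by auto
  then have "degree k = 1" using arg_cong[OF k, of degree] by (subst (asm) degree_mult_eq) auto
  moreover have "[:- C, 1:] dvd 1 \<or> k dvd 1" using assms k by (rule irreducibleD)
  ultimately show False using \<open>k \<noteq> 0\<close> by (auto simp: is_unit_iff_degree)
qed

section \<open>The quadratic extension of even order\<close>

text \<open>Multiplication by a nonzero \<open>x\<close> permutes the nonzero elements, so their
  product absorbs the factor \<open>x ^ card ?U\<close>, which must be 1.\<close>

lemma power_card_field: "x ^ card (UNIV :: 'a set) = (x :: 'a::{field,finite})"
proof (cases "x = 0")
  case False
  let ?U = "UNIV - {0 :: 'a}"
  have "bij_betw ((*) x) ?U ?U"
    by (rule bij_betwI[of _ _ _ "\<lambda>y. y / x"]) (use False in auto)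
  then have "prod id ?U = (\<Prod>y\<in>?U. x * y)"
    using prod.reindex_bij_betw[of "(*) x" ?U ?U id] by simp
  also have "\<dots> = x ^ card ?U * prod id ?U" by (simp add: prod.distrib)
  finally have "x ^ card ?U = 1" by simp
  then have "x ^ Suc (card ?U) = x" by simp
  moreover have "card (UNIV :: 'a set) = Suc (card ?U)" by (rule card.remove) simp_all
  ultimately show ?thesis by metis
qed (simp add: card_gt_0_iff)

text \<open>Irreducibility enters in the form \<open>no_root\<close>: the contradictions drawn from
  it exhibit a root of \<open>X^2 + X + \<gamma>\<close>.\<close>

locale char2_quadratic =
  fixes q e :: nat and \<omega> \<gamma> :: "'a::{field,finite}"
  assumes q_eq: "q = 2 ^ e"
    and card_field: "card (UNIV :: 'a set) = q\<^sup>2"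
    and trace_omega: "\<omega> + \<omega> ^ q = 1"
    and no_root: "C\<^sup>2 + C + \<gamma> \<noteq> 0"
begin

definition cj :: "'a \<Rightarrow> 'a" where "cj x = x ^ q"
definition tr :: "'a \<Rightarrow> 'a" where "tr x = x + cj x"
definition F :: "'a set" where "F = subF q"
definition \<mu> :: 'a where "\<mu> = 1 / \<omega>"
definition \<nu> :: 'a where "\<nu> = 1 / cj \<omega>"

section \<open>Arithmetic in characteristic 2\<close>

lemma char_2: "CHAR('a) = 2"
proof -
  have "CHAR('a) > 0" using finite_imp_CHAR_pos[where ?'a = 'a] finite by blast
  then have "prime CHAR('a)" by (rule prime_CHAR_semidom)
  moreover have "CHAR('a) dvd (2 ^ e)\<^sup>2"
    using CHAR_dvd_CARD[where ?'a = 'a] by (simp add: card_field q_eq)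
  ultimately show ?thesis
    by (metis prime_dvd_power_nat primes_dvd_imp_eq two_is_prime_nat)
qed

text \<open>This and the next simp rules replace minus by plus and cancel repeated summands, so that
  \<open>algebra_simps\<close> decides ring identities of characteristic 2.\<close>

lemma two_eq_0 [simp]: "(2::'a) = 0"
  using of_nat_CHAR[where ?'a = 'a] by (simp add: char_2)

lemma add_self [simp]: "x + x = (0::'a)"
  by (metis mult_2 mult_zero_left two_eq_0)

lemma add_left_self [simp]: "x + (x + y) = (y::'a)"
  by (simp flip: add.assoc)

lemma minus_char2 [simp]: "- x = (x::'a)"
  by (metis add_self minus_unique)

lemma diff_char2 [simp]: "x - y = x + (y::'a)"
  by (metis minus_char2 diff_conv_add_uminus)

lemma add_eq_0_char2 [simp]: "x + y = (0::'a) \<longleftrightarrow> x = y"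
  by (metis diff_char2 eq_iff_diff_eq_0)

lemma square_add: "(x + y)\<^sup>2 = x\<^sup>2 + (y::'a)\<^sup>2"
  by (simp add: power2_sum)

lemma square_inj: "x\<^sup>2 = y\<^sup>2 \<longleftrightarrow> x = (y::'a)"
  by (metis minus_char2 power2_eq_iff)

text \<open>Squaring is injective in characteristic 2, hence surjective on a finite field.\<close>

lemma square_root_exists: "\<exists>y::'a. y\<^sup>2 = x"
proof -
  have "inj (\<lambda>y::'a. y\<^sup>2)" by (simp add: inj_def square_inj)
  then have "surj (\<lambda>y::'a. y\<^sup>2)" by (simp add: finite_UNIV_inj_surj)
  then show ?thesis by (metis surjD)
qed

section \<open>The conjugation, its fixed field \<open>F\<close> and the trace\<close>

lemma cj_add [simp]: "cj (x + y) = cj x + cj y"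
  unfolding cj_def using freshmans_dream'[of "2 ^ e" e x y] by (simp add: char_2 q_eq)

lemma cj_mult [simp]: "cj (x * y) = cj x * cj y"
  by (simp add: cj_def power_mult_distrib)

lemma cj_power [simp]: "cj (x ^ k) = cj x ^ k"
  by (simp add: cj_def flip: power_mult add: mult.commute)

lemma cj_divide [simp]: "cj (x / y) = cj x / cj y"
  by (simp add: cj_def power_divide)

lemma q_pos: "q > 0"
  by (simp add: q_eq)

lemma cj_0 [simp]: "cj 0 = 0" and cj_1 [simp]: "cj 1 = 1"
  using q_pos by (simp_all add: cj_def)

lemma cj_cj [simp]: "cj (cj x) = x"
proof -
  have "cj (cj x) = x ^ card (UNIV :: 'a set)"
    by (simp add: cj_def card_field power2_eq_square flip: power_mult)
  then show ?thesis
    by (simp add: power_card_field)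
qed

lemma cj_eq_0_iff [simp]: "cj x = 0 \<longleftrightarrow> x = 0"
  by (metis cj_0 cj_cj)

lemma F_iff: "x \<in> F \<longleftrightarrow> cj x = x"
  by (simp add: F_def subF_def cj_def)

lemma F_0 [simp]: "0 \<in> F" and F_1 [simp]: "1 \<in> F"
  and F_add [simp]: "x \<in> F \<Longrightarrow> y \<in> F \<Longrightarrow> x + y \<in> F"
  and F_mult [simp]: "x \<in> F \<Longrightarrow> y \<in> F \<Longrightarrow> x * y \<in> F"
  and F_divide [simp]: "x \<in> F \<Longrightarrow> y \<in> F \<Longrightarrow> x / y \<in> F"
  and F_power [simp]: "x \<in> F \<Longrightarrow> x ^ k \<in> F"
  by (simp_all add: F_iff)

lemma F_square_iff [simp]: "x\<^sup>2 \<in> F \<longleftrightarrow> x \<in> F"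
  by (simp add: F_iff square_inj)

lemma F_square_root: "x \<in> F \<Longrightarrow> \<exists>y\<in>F. y\<^sup>2 = x"
  by (metis square_root_exists F_square_iff)

lemma tr_in_F [simp]: "tr x \<in> F"
  by (simp add: F_iff tr_def add.commute)

lemma tr_0 [simp]: "tr 0 = 0"
  by (simp add: tr_def)

lemma tr_add: "tr (x + y) = tr x + tr y"
  by (simp add: tr_def algebra_simps)

lemma tr_scale: "f \<in> F \<Longrightarrow> tr (f * x) = f * tr x"
  by (simp add: tr_def F_iff algebra_simps)

lemma tr_square: "tr (x\<^sup>2) = (tr x)\<^sup>2"
  by (simp add: tr_def square_add)

lemma tr_eq_0_iff: "tr x = 0 \<longleftrightarrow> x \<in> F"
  by (auto simp add: tr_def F_iff)

lemma cj_omega: "cj \<omega> = \<omega> + 1"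
  using trace_omega by (metis cj_def add_left_self)

lemma omega_nonzero [simp]: "\<omega> \<noteq> 0" and cj_omega_nonzero: "\<omega> + 1 \<noteq> 0"
proof -
  show "\<omega> \<noteq> 0" using cj_omega by force
  then show "\<omega> + 1 \<noteq> 0" by (metis cj_omega cj_eq_0_iff)
qed

section \<open>The trace weighted by \<open>\<mu>\<close> and the basis \<open>\<nu>\<close>,
  \<open>\<nu>^2\<close> over \<open>F\<close>\<close>

lemma mu_nonzero [simp]: "\<mu> \<noteq> 0" and nu_nonzero [simp]: "\<nu> \<noteq> 0"
  by (simp_all add: \<mu>_def \<nu>_def)

lemma cj_mu [simp]: "cj \<mu> = \<nu>" and cj_nu [simp]: "cj \<nu> = \<mu>"
  by (simp_all add: \<mu>_def \<nu>_def)

text \<open>Since \<open>\<omega>\<close> has trace 1, its inverse has equal trace and norm.\<close>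

lemma mu_plus_nu: "\<mu> + \<nu> = \<mu> * \<nu>"
  using cj_omega_nonzero by (simp add: \<mu>_def \<nu>_def cj_omega field_simps)

lemma tr_mu: "tr \<mu> = \<mu> * \<nu>"
  by (simp add: tr_def mu_plus_nu)

lemma mu_nu_in_F [simp]: "\<mu> * \<nu> \<in> F"
  by (simp add: F_iff)

lemma nu_not_in_F: "\<nu> \<notin> F"
  using mu_plus_nu mu_nonzero nu_nonzero
  by (metis F_iff add_self cj_nu mult_eq_0_iff)

text \<open>Multiplication by \<open>\<mu>\<close> carries \<open>F \<nu>\<close> onto
  \<open>F\<close>, the kernel of \<open>tr\<close>. This kernel is the freedom left in
  \<open>C\<close> once \<open>tr (\<mu> * C)\<close> is prescribed.\<close>

lemma tr_mu_eq_0: "tr (\<mu> * x) = 0 \<longleftrightarrow> (\<exists>f\<in>F. x = f * \<nu>)"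
proof
  assume "tr (\<mu> * x) = 0"
  then have "\<mu> * x / (\<mu> * \<nu>) \<in> F" by (intro F_divide) (simp_all add: tr_eq_0_iff)
  moreover have "x = (\<mu> * x / (\<mu> * \<nu>)) * \<nu>" by simp
  ultimately show "\<exists>f\<in>F. x = f * \<nu>" by blast
next
  assume "\<exists>f\<in>F. x = f * \<nu>"
  then show "tr (\<mu> * x) = 0" by (auto simp: tr_eq_0_iff) (metis F_mult mu_nu_in_F mult.left_commute)
qed

lemma tr_mu_eq: "tr (\<mu> * x) = tr (\<mu> * y) \<longleftrightarrow> (\<exists>f\<in>F. x = y + f * \<nu>)"
proof -
  have "tr (\<mu> * x) = tr (\<mu> * y) \<longleftrightarrow> tr (\<mu> * (x + y)) = 0"
    by (simp add: tr_add distrib_left)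
  also have "\<dots> \<longleftrightarrow> (\<exists>f\<in>F. x = y + f * \<nu>)"
    unfolding tr_mu_eq_0 by (metis add_left_self add.commute)
  finally show ?thesis .
qed

text \<open>The coefficient \<open>g\<close> is chosen so that \<open>x\<close> and
  \<open>g * \<nu>^2\<close> have the same weighted trace; the remainder then lies in
  \<open>F \<nu>\<close>.\<close>

lemma nu_basis: "\<exists>f\<in>F. \<exists>g\<in>F. x = f * \<nu> + g * \<nu>\<^sup>2"
proof -
  define g where "g = tr (\<mu> * x) / (\<mu> * \<nu>)\<^sup>2"
  have g: "g \<in> F" by (simp add: g_def)
  have "tr (\<mu> * \<nu>\<^sup>2) = (\<mu> * \<nu>)\<^sup>2"
    using tr_scale[OF mu_nu_in_F, of \<nu>]
    by (simp add: tr_def power2_eq_square mult_ac add.commute mu_plus_nu)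
  then have "tr (\<mu> * x) = tr (\<mu> * (g * \<nu>\<^sup>2))"
    using tr_scale[OF g, of "\<mu> * \<nu>\<^sup>2"] by (simp add: g_def mult_ac)
  then show ?thesis unfolding tr_mu_eq using g by (metis add.commute)
qed

lemma nu_indep:
  assumes "f \<in> F" "g \<in> F" "f' \<in> F" "g' \<in> F" "f * \<nu> + g * \<nu>\<^sup>2 = f' * \<nu> + g' * \<nu>\<^sup>2"
  shows "f = f' \<and> g = g'"
proof -
  have "((f + f') + (g + g') * \<nu>) * \<nu> = (f * \<nu> + g * \<nu>\<^sup>2) + (f' * \<nu> + g' * \<nu>\<^sup>2)"
    by (simp add: algebra_simps power2_eq_square)
  then have *: "f + f' = (g + g') * \<nu>" using assms(5) by simp
  have "g + g' = 0"
  proof (rule ccontr)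
    assume "g + g' \<noteq> 0"
    then have "\<nu> = (f + f') / (g + g')" using * by (simp add: field_simps)
    then show False using nu_not_in_F assms by (metis F_add F_divide)
  qed
  then show ?thesis using * by simp
qed

text \<open>The basis identifies the whole field, of size \<open>q^2\<close>, with
  \<open>F \<times> F\<close>.\<close>

lemma card_F: "card F = q"
proof -
  have "bij_betw (\<lambda>(f, g). f * \<nu> + g * \<nu>\<^sup>2) (F \<times> F) UNIV"
    unfolding bij_betw_def inj_on_def using nu_indep nu_basis by (fastforce simp: image_iff)
  then have "card (F \<times> F) = q\<^sup>2" using bij_betw_same_card card_field by fastforce
  then show ?thesis by (simp add: card_cartesian_product flip: power2_eq_square)
qed

section \<open>Artin-Schreier equations\<close>

lemma artin_schreier_fibre: "u\<^sup>2 + u = f\<^sup>2 + f \<longleftrightarrow> u = f \<or> u = f + (1::'a)"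
proof -
  have "(u\<^sup>2 + u) + (f\<^sup>2 + f) = (u + f) * (u + (f + 1))"
    by (simp add: algebra_simps power2_eq_square)
  then show ?thesis by (metis add_eq_0_char2 mult_eq_0_iff)
qed

text \<open>The image \<open>H\<close> of \<open>F\<close> under \<open>f^2 + f\<close> contains at
  least half of \<open>F\<close>, since fibres have at most two elements. A coset of
  \<open>H\<close> inside \<open>F\<close> and disjoint from it therefore fills the rest, and on
  that coset the equation is solved outside \<open>F\<close>.\<close>

lemma F_artin_schreier:
  assumes "k \<in> F"
  shows "\<exists>u::'a. u\<^sup>2 + u = k"
proof -
  define H where "H = (\<lambda>f. f\<^sup>2 + f) ` F"
  have fin: "finite F" by simp
  have HF: "H \<subseteq> F" by (auto simp: H_def)
  have mem_H: "u \<in> F" if u: "u\<^sup>2 + u \<in> H" for u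
  proof -
    obtain f where "f \<in> F" "u\<^sup>2 + u = f\<^sup>2 + f" using u unfolding H_def by blast
    then show ?thesis by (auto simp: artin_schreier_fibre)
  qed
  have card_H: "2 * card H \<ge> card F"
  proof -
    have "card F \<le> (\<Sum>h\<in>H. card {f \<in> F. f\<^sup>2 + f = h})"
      unfolding H_def by (subst card_eq_sum, subst sum.image_gen[OF fin, of _ "\<lambda>f. f\<^sup>2 + f"]) simp
    also have "\<dots> \<le> (\<Sum>h\<in>H. 2)"
    proof (rule sum_mono)
      fix h assume "h \<in> H"
      then obtain g where "h = g\<^sup>2 + g" by (auto simp: H_def)
      then have "{f \<in> F. f\<^sup>2 + f = h} \<subseteq> {g, g + 1}" by (auto simp: artin_schreier_fibre)
      then have "card {f \<in> F. f\<^sup>2 + f = h} \<le> card {g, g + 1}" by (intro card_mono) simp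
      also have "\<dots> \<le> 2" by (simp add: card_insert_if)
      finally show "card {f \<in> F. f\<^sup>2 + f = h} \<le> 2" .
    qed
    finally show ?thesis by simp
  qed
  \<comment> \<open>The conjugate of \<open>\<omega>\<close> is \<open>\<omega> + 1\<close>, so
    \<open>?n\<close> is fixed by \<open>cj\<close>; its two Artin-Schreier roots
    \<open>\<omega>\<close> and \<open>\<omega> + 1\<close> are not in \<open>F\<close>, so
    \<open>?n\<close> is not in \<open>H\<close>.\<close>
  let ?n = "\<omega>\<^sup>2 + \<omega>"
  have "\<omega> \<notin> F" using cj_omega by (auto simp: F_iff)
  have nF: "?n \<in> F" by (simp add: F_iff cj_omega square_add)
  have disj: "H \<inter> (\<lambda>h. ?n + h) ` H = {}"
  proof (rule ccontr)
    assume "H \<inter> (\<lambda>h. ?n + h) ` H \<noteq> {}"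
    then obtain f g where fg: "f \<in> F" "g \<in> F" "f\<^sup>2 + f = ?n + (g\<^sup>2 + g)"
      by (auto simp: H_def)
    have "?n = (f\<^sup>2 + f) + (g\<^sup>2 + g)" using fg(3) by (simp add: add.assoc)
    also have "\<dots> = (f + g)\<^sup>2 + (f + g)" by (simp add: square_add algebra_simps)
    finally have "?n \<in> H"
      unfolding H_def by (rule image_eqI) (use fg in simp)
    then show False using mem_H \<open>\<omega> \<notin> F\<close> by blast
  qed
  have "card (H \<union> (\<lambda>h. ?n + h) ` H) = 2 * card H"
    using disj by (subst card_Un_disjoint) (simp_all add: card_image)
  moreover have "H \<union> (\<lambda>h. ?n + h) ` H \<subseteq> F" using HF nF by auto
  ultimately have "H \<union> (\<lambda>h. ?n + h) ` H = F"
    using card_H fin by (metis card_seteq)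
  then consider "k \<in> H" | "k \<in> (\<lambda>h. ?n + h) ` H" using assms by blast
  then show ?thesis
  proof cases
    case 1
    then show ?thesis by (auto simp: H_def)
  next
    case 2
    then obtain f where "k = ?n + (f\<^sup>2 + f)" by (auto simp: H_def)
    then have "(\<omega> + f)\<^sup>2 + (\<omega> + f) = k" by (simp add: square_add algebra_simps)
    then show ?thesis by blast
  qed
qed

section \<open>Totally isotropic planes\<close>

definition scale :: "'a \<Rightarrow> 'a \<times> 'a \<times> 'a \<times> 'a \<Rightarrow> 'a \<times> 'a \<times> 'a \<times> 'a" where
  "scale f = (\<lambda>(A, B, s, d). (f * A, f * B, f * s, f * d))"

definition form :: "'a \<times> 'a \<times> 'a \<times> 'a \<Rightarrow> 'a \<times> 'a \<times> 'a \<times> 'a \<Rightarrow> 'a" where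
  "form = (\<lambda>(A, B, s, d) (A', B', s', d'). tr (\<mu> * (A * B' + A' * B)) + s * d' + s' * d)"

definition on_O :: "'a \<times> 'a \<times> 'a \<times> 'a \<Rightarrow> bool" where
  "on_O = (\<lambda>(A, B, s, d). \<exists>C. A * B = C\<^sup>2 + d * C + d\<^sup>2 * \<gamma> \<and> tr (\<mu> * C) = s)"

definition V :: "('a \<times> 'a \<times> 'a \<times> 'a) set" where
  "V = {(A, B, s, d). s \<in> F \<and> d \<in> F}"

text \<open>The dimension is recorded separately, as \<open>card W = q ^ 3\<close>, for the planes
  that arise from generators.\<close>

definition isotropic :: "('a \<times> 'a \<times> 'a \<times> 'a) set \<Rightarrow> bool" where
  "isotropic W \<longleftrightarrow> W \<subseteq> V \<and> (\<forall>w\<in>W. \<forall>w'\<in>W. w + w' \<in> W \<and> form w w' = 0)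
     \<and> (\<forall>f\<in>F. \<forall>w\<in>W. scale f w \<in> W)"

text \<open>\<open>transversal r W\<close> says that \<open>r\<close> is a nucleus of the conic cut out on \<open>W\<close>.\<close>
definition transversal :: "'a \<times> 'a \<times> 'a \<times> 'a \<Rightarrow> ('a \<times> 'a \<times> 'a \<times> 'a) set \<Rightarrow> bool" where
  "transversal r W \<longleftrightarrow> r \<in> W \<and> (\<forall>w\<in>W. \<exists>!t. t \<in> F \<and> on_O (w + scale t r))"

lemma scale_simp [simp]: "scale f (A, B, s, d) = (f * A, f * B, f * s, f * d)"
  by (simp add: scale_def)

lemma form_simp: "form (A, B, s, d) (A', B', s', d') = tr (\<mu> * (A * B' + A' * B)) + s * d' + s' * d"
  by (simp add: form_def)

lemma on_O_simp: "on_O (A, B, s, d) \<longleftrightarrow> (\<exists>C. A * B = C\<^sup>2 + d * C + d\<^sup>2 * \<gamma> \<and> tr (\<mu> * C) = s)"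
  by (simp add: on_O_def)

lemma isotropic_add: "isotropic W \<Longrightarrow> w \<in> W \<Longrightarrow> w' \<in> W \<Longrightarrow> w + w' \<in> W"
  and isotropic_scale: "isotropic W \<Longrightarrow> f \<in> F \<Longrightarrow> w \<in> W \<Longrightarrow> scale f w \<in> W"
  and isotropic_form: "isotropic W \<Longrightarrow> w \<in> W \<Longrightarrow> w' \<in> W \<Longrightarrow> form w w' = 0"
  and isotropic_F: "isotropic W \<Longrightarrow> (A, B, s, d) \<in> W \<Longrightarrow> s \<in> F \<and> d \<in> F"
  by (auto simp: isotropic_def V_def)

lemma isotropic_add': "isotropic W \<Longrightarrow> (A, B, s, d) \<in> W \<Longrightarrow> (A', B', s', d') \<in> W \<Longrightarrow>
    (A + A', B + B', s + s', d + d') \<in> W"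
  using isotropic_add[of W "(A, B, s, d)" "(A', B', s', d')"] by simp

lemma isotropic_scale': "isotropic W \<Longrightarrow> f \<in> F \<Longrightarrow> (A, B, s, d) \<in> W \<Longrightarrow>
    (f * A, f * B, f * s, f * d) \<in> W"
  using isotropic_scale[of W f "(A, B, s, d)"] by simp

lemma q_gt_1: "q > 1"
proof (rule ccontr)
  assume "\<not> q > 1"
  then have "q = 1" using q_pos by simp
  then have "card (UNIV :: 'a set) = 1" using card_field by simp
  then show False using card_mono[of "UNIV :: 'a set" "{0, 1}"] by simp
qed

text \<open>The additive shift by \<open>A0 * B + A * B0\<close> in \<open>C\<close> removes the terms linear in \<open>(A, B)\<close>.\<close>
lemma on_O_affine:
  assumes "f \<in> F" "tr (\<mu> * C0) = s0"
  shows "on_O (A + f * A0, B + f * B0, tr (\<mu> * (A0 * B + A * B0)) + f * s0, f) \<longleftrightarrow>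
    (\<exists>e\<in>F. A * B + (A0 * B + A * B0)\<^sup>2 + f\<^sup>2 * (A0 * B0 + \<gamma> + C0\<^sup>2 + C0) = e\<^sup>2 * \<nu>\<^sup>2 + f * e * \<nu>)"
proof -
  let ?x = "A0 * B + A * B0"
  \<comment> \<open>\<open>?x + f * C0\<close> is one \<open>C\<close> with the required trace; all
    others differ from it by an element of \<open>F \<nu>\<close>.\<close>
  have trC: "tr (\<mu> * C) = tr (\<mu> * ?x) + f * s0 \<longleftrightarrow> (\<exists>e\<in>F. C = ?x + f * C0 + e * \<nu>)" for C
  proof -
    have "tr (\<mu> * ?x) + f * s0 = tr (\<mu> * (?x + f * C0))"
      using tr_scale[OF assms(1), of "\<mu> * C0"] assms(2)
      by (simp add: distrib_left[of \<mu> ?x] tr_add mult_ac)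
    then show ?thesis by (simp add: tr_mu_eq)
  qed
  have eq: "(A + f * A0) * (B + f * B0) = (?x + f * C0 + e * \<nu>)\<^sup>2 + f * (?x + f * C0 + e * \<nu>) + f\<^sup>2 * \<gamma>
      \<longleftrightarrow> A * B + ?x\<^sup>2 + f\<^sup>2 * (A0 * B0 + \<gamma> + C0\<^sup>2 + C0) = e\<^sup>2 * \<nu>\<^sup>2 + f * e * \<nu>" (is "?l = ?r \<longleftrightarrow> ?l' = ?r'") for e
  proof -
    \<comment> \<open>In characteristic 2 two equations are equivalent as soon as their four sides
      add up to 0.\<close>
    have "?l + ?r = ?l' + ?r'"
      by (simp add: square_add power_mult_distrib algebra_simps) (simp add: power2_eq_square algebra_simps)
    then show ?thesis by (metis add_eq_0_char2)
  qed
  show ?thesis unfolding on_O_simp trC using eq by auto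
qed

text \<open>Adding \<open>l * \<nu>\<close> to \<open>C\<close> keeps the trace and adds
  \<open>l^2 * \<nu>^2 + l * \<nu>\<close> to the value, so taking for \<open>l\<close> the square
  root of the \<open>\<nu>^2\<close>-component removes that component.\<close>

lemma normalised_C:
  assumes "s \<in> F"
  shows "\<exists>C k. tr (\<mu> * C) = s \<and> k \<in> F \<and> y + C\<^sup>2 + C = k * \<nu>"
proof -
  \<comment> \<open>A solution of the trace condition, because
    \<open>tr \<mu> = \<mu> * \<nu>\<close>.\<close>
  define C where "C = s / (\<mu> * \<nu>)"
  have "tr (\<mu> * C) = s"
    using tr_scale[of "s / (\<mu> * \<nu>)" \<mu>] assms by (simp add: C_def tr_mu mult_ac)
  obtain k1 k2 where k: "k1 \<in> F" "k2 \<in> F" "y + C\<^sup>2 + C = k1 * \<nu> + k2 * \<nu>\<^sup>2"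
    using nu_basis by meson
  obtain l where l: "l \<in> F" "l\<^sup>2 = k2" using F_square_root k(2) by blast
  have "tr (\<mu> * (C + l * \<nu>)) = tr (\<mu> * C)" unfolding tr_mu_eq using l(1) by blast
  moreover have "y + (C + l * \<nu>)\<^sup>2 + (C + l * \<nu>) = (k1 + l) * \<nu>"
  proof -
    have "y + (C + l * \<nu>)\<^sup>2 + (C + l * \<nu>) = (y + C\<^sup>2 + C) + (l\<^sup>2 * \<nu>\<^sup>2 + l * \<nu>)"
      by (simp add: square_add power_mult_distrib algebra_simps)
    also have "\<dots> = (k1 * \<nu> + k2 * \<nu>\<^sup>2) + (k2 * \<nu>\<^sup>2 + l * \<nu>)" by (simp only: k(3) l(2))
    also have "\<dots> = (k1 + l) * \<nu>" by (simp add: algebra_simps)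
    finally show ?thesis .
  qed
  ultimately show ?thesis using k l \<open>tr (\<mu> * C) = s\<close> by (metis F_add)
qed

text \<open>The hypotheses force \<open>A0 * B0 = v^2 + v\<close> for some \<open>v\<close>, namely
  \<open>v = y + z + u\<close>. An equality \<open>A0 * B0 = C^2 + C + \<gamma>\<close> would then
  make \<open>C + v\<close> a root of the irreducible quadratic.\<close>

lemma no_affine_point_of_det_nonzero:
  assumes "b \<in> F" "b \<noteq> 0" "r1 \<in> F" "r2 \<in> F" and det: "A1 * B2 + A2 * B1 = b * \<nu>"
    and r1: "A1 * B1 + (A0 * B1 + A1 * B0)\<^sup>2 = r1 * \<nu>"
    and r2: "A2 * B2 + (A0 * B2 + A2 * B0)\<^sup>2 = r2 * \<nu>"
  shows "A0 * B0 \<noteq> C\<^sup>2 + C + \<gamma>"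
proof
  assume C: "A0 * B0 = C\<^sup>2 + C + \<gamma>"
  define n where "n = b * \<nu>"
  have n: "n \<noteq> 0" using assms(2) by (simp add: n_def)
  define x1 where "x1 = A0 * B1 + A1 * B0"
  define x2 where "x2 = A0 * B2 + A2 * B0"
  define y where "y = A1 * B2 / n"
  define z where "z = x1 * x2 / n"
  obtain u where u: "u\<^sup>2 + u = r1 * r2 / b\<^sup>2"
    using F_artin_schreier[of "r1 * r2 / b\<^sup>2"] assms by auto
  have R1: "A1 * B1 = x1\<^sup>2 + r1 * \<nu>" using r1 by (simp add: x1_def flip: r1)
  have R2: "A2 * B2 = x2\<^sup>2 + r2 * \<nu>" using r2 by (simp add: x2_def flip: r2)
  \<comment> \<open>Cramer's rule for the linear system that defines \<open>x1\<close> and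
    \<open>x2\<close>; its determinant is \<open>n\<close>.\<close>
  have A0: "n * A0 = x1 * A2 + x2 * A1" and B0: "n * B0 = x1 * B2 + x2 * B1"
    by (simp_all add: n_def x1_def x2_def algebra_simps flip: det)
  have "n\<^sup>2 * (A0 * B0) = (n * A0) * (n * B0)" by (simp add: power2_eq_square)
  also have "\<dots> = x1\<^sup>2 * (A2 * B2) + x2\<^sup>2 * (A1 * B1) + x1 * x2 * (A1 * B2 + A2 * B1)"
    unfolding A0 B0 by (simp add: power2_eq_square algebra_simps)
  also have "\<dots> = (x1\<^sup>2 * r2 + x2\<^sup>2 * r1) * \<nu> + x1 * x2 * n"
    unfolding R1 R2 det n_def by (simp add: algebra_simps)
  finally have e1: "n\<^sup>2 * (A0 * B0) = (x1\<^sup>2 * r2 + x2\<^sup>2 * r1) * \<nu> + n\<^sup>2 * z"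
    using n by (simp add: z_def power2_eq_square)
  \<comment> \<open>The elements \<open>A1 * B2\<close> and \<open>A2 * B1\<close> have sum
    \<open>n\<close> and product \<open>(A1 * B1) * (A2 * B2)\<close>, which is known from
    \<open>R1\<close> and \<open>R2\<close>. The leftover \<open>r1 * r2\<close> is the term that
    \<open>u\<close> was chosen to express.\<close>
  have "n\<^sup>2 * (y\<^sup>2 + y) = (A1 * B2) * (A1 * B2 + n)"
    using n by (simp add: y_def power2_eq_square field_simps)
  also have "\<dots> = (A1 * B1) * (A2 * B2)"
    by (simp add: n_def flip: det)
  also have "\<dots> = (x1 * x2)\<^sup>2 + (x1\<^sup>2 * r2 + x2\<^sup>2 * r1) * \<nu> + r1 * r2 * \<nu>\<^sup>2"
    unfolding R1 R2 by (simp add: power2_eq_square algebra_simps)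
  also have "\<dots> = n\<^sup>2 * z\<^sup>2 + (x1\<^sup>2 * r2 + x2\<^sup>2 * r1) * \<nu> + n\<^sup>2 * (u\<^sup>2 + u)"
    using n assms(2) unfolding u z_def by (simp add: n_def power_divide power_mult_distrib)
  finally have e2: "n\<^sup>2 * (y\<^sup>2 + y) = \<dots>" .
  have "n\<^sup>2 * (A0 * B0) = n\<^sup>2 * (y\<^sup>2 + y) + n\<^sup>2 * z\<^sup>2 + n\<^sup>2 * (u\<^sup>2 + u) + n\<^sup>2 * z"
    unfolding e1 e2 by (simp add: add_ac)
  also have "\<dots> = n\<^sup>2 * (y\<^sup>2 + y + z\<^sup>2 + (u\<^sup>2 + u) + z)"
    by (simp add: distrib_left)
  finally have "n\<^sup>2 * (A0 * B0) = n\<^sup>2 * (y\<^sup>2 + y + z\<^sup>2 + (u\<^sup>2 + u) + z)" .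
  then have "A0 * B0 = y\<^sup>2 + y + z\<^sup>2 + (u\<^sup>2 + u) + z" using n by simp
  then have "(C + y + z + u)\<^sup>2 + (C + y + z + u) + \<gamma> = A0 * B0 + (C\<^sup>2 + C + \<gamma>)"
    by (simp add: square_add algebra_simps)
  then show False using C no_root by simp
qed

section \<open>Nuclei of totally isotropic planes: affine points have \<open>d = 1\<close>,
  directions have \<open>d = 0\<close>\<close>

lemma isotropic_direction:
  assumes "isotropic W" "(A0, B0, s0, 1) \<in> W" "(A, B, s, 0) \<in> W"
  shows "s = tr (\<mu> * (A0 * B + A * B0))"
  using isotropic_form[OF assms] by (simp add: form_simp)

lemma isotropic_decompose:
  assumes "isotropic W" "(A0, B0, s0, 1) \<in> W" "w \<in> W"
  obtains A B f where "f \<in> F" "(A, B, tr (\<mu> * (A0 * B + A * B0)), 0) \<in> W"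
    "w = (A + f * A0, B + f * B0, tr (\<mu> * (A0 * B + A * B0)) + f * s0, f)"
proof -
  obtain A B s f where w: "w = (A, B, s, f)" by (cases w)
  have f: "f \<in> F" using assms isotropic_F w by blast
  have *: "(A + f * A0, B + f * B0, s + f * s0, 0) \<in> W"
    using isotropic_add'[OF assms(1), of A B s f] isotropic_scale'[OF assms(1) f assms(2)] assms(3) w
    by fastforce
  note s = isotropic_direction[OF assms(1,2) *]
  have "w = (A + f * A0 + f * A0, B + f * B0 + f * B0, s + f * s0 + f * s0, f)"
    by (simp add: w add.assoc)
  then show ?thesis using * that[OF f] unfolding s by blast
qed

text \<open>If the quadratic map on directions takes values in \<open>F \<nu>\<close>, then
  comparing \<open>\<nu>^2\<close>-components in \<open>on_O_affine\<close> forces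
  \<open>e = 0\<close>. What remains is a nondegenerate equation for \<open>(f + t)^2\<close>, and
  square roots in \<open>F\<close> are unique.\<close>

lemma transversal_affine_point:
  assumes W: "isotropic W" and p: "(A0, B0, s0, 1) \<in> W"
    and R: "\<And>A B s. (A, B, s, 0) \<in> W \<Longrightarrow> \<exists>h\<in>F. A * B + (A0 * B + A * B0)\<^sup>2 = h * \<nu>"
    and not_O: "\<And>C. A0 * B0 \<noteq> C\<^sup>2 + C + \<gamma>"
  shows "transversal (A0, B0, s0, 1) W"
  unfolding transversal_def
proof (intro conjI ballI p)
  fix w assume "w \<in> W"
  then obtain A B f where f: "f \<in> F" and v: "(A, B, tr (\<mu> * (A0 * B + A * B0)), 0) \<in> W"
    and w: "w = (A + f * A0, B + f * B0, tr (\<mu> * (A0 * B + A * B0)) + f * s0, f)"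
    using isotropic_decompose[OF W p] by metis
  obtain h where h: "h \<in> F" "A * B + (A0 * B + A * B0)\<^sup>2 = h * \<nu>" using R[OF v] by blast
  have "s0 \<in> F" using isotropic_F W p by blast
  \<comment> \<open>With this \<open>C0\<close> the constant term of the affine equation lies in
    \<open>F \<nu>\<close> too; \<open>not_O\<close> makes its coefficient \<open>k\<close>
    nonzero.\<close>
  then obtain C0 k where C0: "tr (\<mu> * C0) = s0" and k: "k \<in> F" "A0 * B0 + \<gamma> + C0\<^sup>2 + C0 = k * \<nu>"
    using normalised_C by meson
  have k0: "k \<noteq> 0"
  proof
    assume "k = 0"
    then have "A0 * B0 = C0\<^sup>2 + C0 + \<gamma>" using k(2) by (simp add: add.assoc)
    then show False using not_O by blast
  qed
  have on: "on_O (w + scale t (A0, B0, s0, 1)) \<longleftrightarrow> (f + t)\<^sup>2 = h / k" if t: "t \<in> F" for t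
  proof -
    have "w + scale t (A0, B0, s0, 1) = (A + (f + t) * A0, B + (f + t) * B0,
        tr (\<mu> * (A0 * B + A * B0)) + (f + t) * s0, f + t)"
      by (simp add: w algebra_simps)
    then have "on_O (w + scale t (A0, B0, s0, 1)) \<longleftrightarrow>
        (\<exists>e\<in>F. h * \<nu> + (f + t)\<^sup>2 * (k * \<nu>) = e\<^sup>2 * \<nu>\<^sup>2 + (f + t) * e * \<nu>)"
      using on_O_affine[OF _ C0, of "f + t" A A0 B B0] f t h(2) k(2) by simp
    also have "\<dots> \<longleftrightarrow> (\<exists>e\<in>F. (h + (f + t)\<^sup>2 * k) * \<nu> + 0 * \<nu>\<^sup>2 = (f + t) * e * \<nu> + e\<^sup>2 * \<nu>\<^sup>2)"
      by (simp add: algebra_simps)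
    also have "\<dots> \<longleftrightarrow> h + (f + t)\<^sup>2 * k = 0"
    proof
      assume "\<exists>e\<in>F. (h + (f + t)\<^sup>2 * k) * \<nu> + 0 * \<nu>\<^sup>2 = (f + t) * e * \<nu> + e\<^sup>2 * \<nu>\<^sup>2"
      then obtain e where "e \<in> F"
        "(h + (f + t)\<^sup>2 * k) * \<nu> + 0 * \<nu>\<^sup>2 = (f + t) * e * \<nu> + e\<^sup>2 * \<nu>\<^sup>2" by blast
      then have "h + (f + t)\<^sup>2 * k = (f + t) * e \<and> 0 = e\<^sup>2"
        by (intro nu_indep) (use f t h k in simp_all)
      then show "h + (f + t)\<^sup>2 * k = 0" by force
    next
      assume "h + (f + t)\<^sup>2 * k = 0"
      then show "\<exists>e\<in>F. (h + (f + t)\<^sup>2 * k) * \<nu> + 0 * \<nu>\<^sup>2 = (f + t) * e * \<nu> + e\<^sup>2 * \<nu>\<^sup>2"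
        by (intro bexI[of _ 0]) simp_all
    qed
    also have "\<dots> \<longleftrightarrow> (f + t)\<^sup>2 = h / k" using k0 by (auto simp: field_simps)
    finally show ?thesis .
  qed
  obtain l where l: "l \<in> F" "l\<^sup>2 = h / k" using F_square_root[of "h / k"] h k by auto
  show "\<exists>!t. t \<in> F \<and> on_O (w + scale t (A0, B0, s0, 1))"
  proof (rule ex1I[of _ "f + l"])
    show "f + l \<in> F \<and> on_O (w + scale (f + l) (A0, B0, s0, 1))" using on f l by simp
    fix t assume t: "t \<in> F \<and> on_O (w + scale t (A0, B0, s0, 1))"
    then have "(f + t)\<^sup>2 = l\<^sup>2" using on l by metis
    then show "t = f + l" unfolding square_inj by (metis add_left_self)
  qed
qed

text \<open>Two directions with nonzero determinant span all directions modulo \<open>s\<close>. The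
  nucleus is an affine point of \<open>W\<close>, corrected so that the quadratic map on directions
  loses its \<open>\<nu>^2\<close>-component.\<close>

lemma transversal_det_nonzero:
  assumes W: "isotropic W" and p: "(A0, B0, s0, 1) \<in> W"
    and v1: "(A1, B1, s1, 0) \<in> W" and v2: "(A2, B2, s2, 0) \<in> W"
    and det0: "A1 * B2 + A2 * B1 \<noteq> 0"
  shows "\<exists>r. transversal r W"
proof -
  \<comment> \<open>For directions the form reduces to the weighted trace of the determinant, whose
    kernel is \<open>F \<nu>\<close>.\<close>
  have det_F: "\<exists>b\<in>F. A * B' + A' * B = b * \<nu>" if "(A, B, s, 0) \<in> W" "(A', B', s', 0) \<in> W" for A B s A' B' s'
    using isotropic_form[OF W that] by (simp add: form_simp tr_mu_eq_0)
  obtain b where b: "b \<in> F" "A1 * B2 + A2 * B1 = b * \<nu>" using det_F[OF v1 v2] by blast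
  have b0: "b \<noteq> 0" using b(2) det0 by auto
  have "\<exists>r\<in>F. \<exists>l\<in>F. A * B + (A0 * B + A * B0)\<^sup>2 = r * \<nu> + l\<^sup>2 * \<nu>\<^sup>2" for A B
    using nu_basis F_square_root by metis
  then obtain r1 l1 r2 l2 where r: "r1 \<in> F" "r2 \<in> F" and l: "l1 \<in> F" "l2 \<in> F"
    and R1: "A1 * B1 + (A0 * B1 + A1 * B0)\<^sup>2 = r1 * \<nu> + l1\<^sup>2 * \<nu>\<^sup>2"
    and R2: "A2 * B2 + (A0 * B2 + A2 * B0)\<^sup>2 = r2 * \<nu> + l2\<^sup>2 * \<nu>\<^sup>2"
    by metis
  \<comment> \<open>Moving the affine point by this vector of \<open>W\<close> kills both \<open>\<nu>\<^sup>2\<close>-components.\<close>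
  define A0' where "A0' = A0 + (l2 / b * A1 + l1 / b * A2)"
  define B0' where "B0' = B0 + (l2 / b * B1 + l1 / b * B2)"
  define s0' where "s0' = s0 + (l2 / b * s1 + l1 / b * s2)"
  have v0: "(l2 / b * A1 + l1 / b * A2, l2 / b * B1 + l1 / b * B2, l2 / b * s1 + l1 / b * s2, 0) \<in> W"
    using isotropic_add'[OF W isotropic_scale'[OF W _ v1] isotropic_scale'[OF W _ v2], of "l2 / b" "l1 / b"] l b
    by simp
  have p': "(A0', B0', s0', 1) \<in> W"
    using isotropic_add'[OF W p v0] by (simp add: A0'_def B0'_def s0'_def)
  have x1: "A0' * B1 + A1 * B0' = (A0 * B1 + A1 * B0) + l1 * \<nu>"
  proof -
    have "A0' * B1 + A1 * B0' = (A0 * B1 + A1 * B0) + l1 / b * (A1 * B2 + A2 * B1)"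
      by (simp add: A0'_def B0'_def algebra_simps)
    then show ?thesis using b b0 by simp
  qed
  have x2: "A0' * B2 + A2 * B0' = (A0 * B2 + A2 * B0) + l2 * \<nu>"
  proof -
    have "A0' * B2 + A2 * B0' = (A0 * B2 + A2 * B0) + l2 / b * (A1 * B2 + A2 * B1)"
      by (simp add: A0'_def B0'_def algebra_simps)
    then show ?thesis using b b0 by simp
  qed
  have R1': "A1 * B1 + (A0' * B1 + A1 * B0')\<^sup>2 = r1 * \<nu>"
    unfolding x1 square_add[of "A0 * B1 + A1 * B0"] add.assoc[symmetric] R1
    by (simp add: power_mult_distrib add.assoc)
  have R2': "A2 * B2 + (A0' * B2 + A2 * B0')\<^sup>2 = r2 * \<nu>"
    unfolding x2 square_add[of "A0 * B2 + A2 * B0"] add.assoc[symmetric] R2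
    by (simp add: power_mult_distrib add.assoc)
  have "\<exists>h\<in>F. A * B + (A0' * B + A * B0')\<^sup>2 = h * \<nu>" if v: "(A, B, s, 0) \<in> W" for A B s
  proof -
    obtain b1 where b1: "b1 \<in> F" "A * B1 + A1 * B = b1 * \<nu>" using det_F[OF v v1] by blast
    obtain b2 where b2: "b2 \<in> F" "A * B2 + A2 * B = b2 * \<nu>" using det_F[OF v v2] by blast
    define f g where "f = b2 / b" and "g = b1 / b"
    have fg: "f \<in> F" "g \<in> F" using b b1 b2 by (simp_all add: f_def g_def)
    \<comment> \<open>Cramer's rule again; the coefficients lie in \<open>F\<close> because all
      three determinants lie in \<open>F \<nu>\<close> and \<open>\<nu>\<close> cancels.\<close>
    have "b * \<nu> * A = b2 * \<nu> * A1 + b1 * \<nu> * A2" "b * \<nu> * B = b2 * \<nu> * B1 + b1 * \<nu> * B2"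
      unfolding b1(2)[symmetric] b2(2)[symmetric] b(2)[symmetric] by (simp_all add: algebra_simps)
    then have "\<nu> * (b * A) = \<nu> * (b2 * A1 + b1 * A2)" "\<nu> * (b * B) = \<nu> * (b2 * B1 + b1 * B2)"
      by (simp_all add: algebra_simps)
    then have "b * A = b2 * A1 + b1 * A2" "b * B = b2 * B1 + b1 * B2"
      by simp_all
    then have AB: "A = f * A1 + g * A2" "B = f * B1 + g * B2"
      using b0 by (simp_all add: f_def g_def field_simps)
    \<comment> \<open>The squared part is additive, so the cross term is the determinant alone,
      again in \<open>F \<nu>\<close>.\<close>
    have "A * B + (A0' * B + A * B0')\<^sup>2 = f\<^sup>2 * (A1 * B1 + (A0' * B1 + A1 * B0')\<^sup>2)
        + g\<^sup>2 * (A2 * B2 + (A0' * B2 + A2 * B0')\<^sup>2) + f * g * (A1 * B2 + A2 * B1)"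
      unfolding AB by (simp add: square_add power_mult_distrib algebra_simps) (simp add: power2_eq_square)
    also have "\<dots> = (f\<^sup>2 * r1 + g\<^sup>2 * r2 + f * g * b) * \<nu>"
      unfolding R1' R2' b(2) by (simp add: algebra_simps)
    finally show ?thesis
      by (intro bexI[of _ "f\<^sup>2 * r1 + g\<^sup>2 * r2 + f * g * b"]) (use fg r b(1) in simp_all)
  qed
  moreover have "A0' * B0' \<noteq> C\<^sup>2 + C + \<gamma>" for C
    by (rule no_affine_point_of_det_nonzero[OF b(1) b0 r b(2) R1' R2'])
  ultimately show ?thesis using transversal_affine_point[OF W p'] by blast
qed

text \<open>Here the directions project onto a \<open>GF(q^2)\<close>-line, on which the quadratic
  map is \<open>x^2 * \<rho>\<close>. If \<open>\<rho> = 0\<close>, the affine point is a nucleus,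
  since \<open>A0 * B0 = 0\<close> is not of the form \<open>C^2 + C + \<gamma>\<close>. Otherwise a
  direction serves as nucleus.\<close>

lemma transversal_line:
  assumes W: "isotropic W" and p: "(A0, B0, s0, 1) \<in> W" and p0: "A0 * B0 = 0"
    and line: "\<And>x. \<exists>s. (x * A1, x * B1, s, 0) \<in> W"
    and det0: "\<And>A B s. (A, B, s, 0) \<in> W \<Longrightarrow> A * B1 = A1 * B" and nz: "A1 \<noteq> 0 \<or> B1 \<noteq> 0"
  shows "\<exists>r. transversal r W"
proof -
  define \<rho> where "\<rho> = A1 * B1 + (A0 * B1 + A1 * B0)\<^sup>2"
  have R: "(x * A1) * (x * B1) + (A0 * (x * B1) + (x * A1) * B0)\<^sup>2 = x\<^sup>2 * \<rho>" for x
    by (simp add: \<rho>_def square_add power_mult_distrib algebra_simps) (simp add: power2_eq_square)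
  have multiple: "\<exists>x. A = x * A1 \<and> B = x * B1" if "(A, B, s, 0) \<in> W" for A B s
  proof (cases "A1 = 0")
    case True
    then show ?thesis using nz det0[OF that] by (intro exI[of _ "B / B1"]) simp
  next
    case False
    then show ?thesis using det0[OF that] by (intro exI[of _ "A / A1"]) (simp add: field_simps)
  qed
  show ?thesis
  proof (cases "\<rho> = 0")
    case True
    have "\<exists>h\<in>F. A * B + (A0 * B + A * B0)\<^sup>2 = h * \<nu>" if "(A, B, s, 0) \<in> W" for A B s
      using multiple[OF that] R True by (intro bexI[of _ 0]) (elim exE conjE, simp_all)
    moreover have "A0 * B0 \<noteq> C\<^sup>2 + C + \<gamma>" for C using no_root p0 by metis
    ultimately show ?thesis using transversal_affine_point[OF W p] by blast
  next
    case False
    \<comment> \<open>This scaling gives the new direction the value exactly \<open>\<nu>\<close>.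
      As determinants vanish, adding \<open>t\<close> times it changes the equation only by
      \<open>t^2 * \<nu>\<close>.\<close>
    obtain y where y: "y\<^sup>2 = \<nu> / \<rho>" using square_root_exists by blast
    define A2 B2 where "A2 = y * A1" and "B2 = y * B1"
    obtain s2 where v2: "(A2, B2, s2, 0) \<in> W" unfolding A2_def B2_def using line by blast
    have s2: "s2 = tr (\<mu> * (A0 * B2 + A2 * B0))" by (rule isotropic_direction[OF W p v2])
    have R2: "A2 * B2 + (A0 * B2 + A2 * B0)\<^sup>2 = \<nu>"
      unfolding A2_def B2_def R y using False by simp
    have "s0 \<in> F" using isotropic_F W p by blast
    then obtain C0 where C0: "tr (\<mu> * C0) = s0" using normalised_C by meson
    have "\<exists>!t. t \<in> F \<and> on_O (w + scale t (A2, B2, s2, 0))" if "w \<in> W" for w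
    proof -
      obtain A B f where f: "f \<in> F" and v: "(A, B, tr (\<mu> * (A0 * B + A * B0)), 0) \<in> W"
        and w: "w = (A + f * A0, B + f * B0, tr (\<mu> * (A0 * B + A * B0)) + f * s0, f)"
        using isotropic_decompose[OF W p \<open>w \<in> W\<close>] by metis
      have det2: "A * B2 = A2 * B" using det0[OF v] by (simp add: A2_def B2_def mult_ac)
      let ?K = "A0 * B0 + \<gamma> + C0\<^sup>2 + C0"
      obtain g1 g2 where g: "g1 \<in> F" "g2 \<in> F"
        "A * B + (A0 * B + A * B0)\<^sup>2 + f\<^sup>2 * ?K = g1 * \<nu> + g2 * \<nu>\<^sup>2" using nu_basis by meson
      obtain e where e: "e \<in> F" "e\<^sup>2 = g2" using F_square_root g(2) by blast
      have on: "on_O (w + scale t (A2, B2, s2, 0)) \<longleftrightarrow> t\<^sup>2 = g1 + f * e" if t: "t \<in> F" for t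
      proof -
        let ?A = "A + t * A2" and ?B = "B + t * B2"
        have "tr (\<mu> * (A0 * ?B + ?A * B0)) = tr (\<mu> * (A0 * B + A * B0)) + t * s2"
        proof -
          have "\<mu> * (A0 * ?B + ?A * B0) = \<mu> * (A0 * B + A * B0) + t * (\<mu> * (A0 * B2 + A2 * B0))"
            by (simp add: algebra_simps)
          then show ?thesis by (simp only: tr_add tr_scale[OF t] s2)
        qed
        then have "w + scale t (A2, B2, s2, 0) =
            (?A + f * A0, ?B + f * B0, tr (\<mu> * (A0 * ?B + ?A * B0)) + f * s0, f)"
          by (simp add: w add_ac)
        then have "on_O (w + scale t (A2, B2, s2, 0)) \<longleftrightarrow>
          (\<exists>e\<in>F. ?A * ?B + (A0 * ?B + ?A * B0)\<^sup>2 + f\<^sup>2 * ?K = e\<^sup>2 * \<nu>\<^sup>2 + f * e * \<nu>)"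
          using on_O_affine[OF f C0] by simp
        also have "?A * ?B + (A0 * ?B + ?A * B0)\<^sup>2 + f\<^sup>2 * ?K = (g1 + t\<^sup>2) * \<nu> + g2 * \<nu>\<^sup>2"
        proof -
          have "?A * ?B + (A0 * ?B + ?A * B0)\<^sup>2 + f\<^sup>2 * ?K = (A * B + (A0 * B + A * B0)\<^sup>2 + f\<^sup>2 * ?K)
             + t\<^sup>2 * (A2 * B2 + (A0 * B2 + A2 * B0)\<^sup>2) + t * (A * B2 + A2 * B)"
            by (simp add: square_add power_mult_distrib algebra_simps) (simp add: power2_eq_square)
          then show ?thesis unfolding g(3) R2 det2 by (simp add: algebra_simps)
        qed
        \<comment> \<open>The \<open>\<nu>^2\<close>-component determines \<open>e'\<close>
          irrespective of \<open>t\<close>; the \<open>\<nu>\<close>-component then determines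
          \<open>t^2\<close>.\<close>
        also have "(\<exists>e'\<in>F. (g1 + t\<^sup>2) * \<nu> + g2 * \<nu>\<^sup>2 = e'\<^sup>2 * \<nu>\<^sup>2 + f * e' * \<nu>) \<longleftrightarrow> t\<^sup>2 = g1 + f * e"
        proof
          assume "\<exists>e'\<in>F. (g1 + t\<^sup>2) * \<nu> + g2 * \<nu>\<^sup>2 = e'\<^sup>2 * \<nu>\<^sup>2 + f * e' * \<nu>"
          then obtain e' where e': "e' \<in> F"
            "(g1 + t\<^sup>2) * \<nu> + g2 * \<nu>\<^sup>2 = f * e' * \<nu> + e'\<^sup>2 * \<nu>\<^sup>2" by (metis add.commute)
          then have *: "g1 + t\<^sup>2 = f * e' \<and> g2 = e'\<^sup>2"
            by (intro nu_indep) (use f t g in simp_all)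
          then have "e' = e" using e(2) square_inj by metis
          then show "t\<^sup>2 = g1 + f * e" using * by (metis add_left_self)
        next
          assume "t\<^sup>2 = g1 + f * e"
          then show "\<exists>e'\<in>F. (g1 + t\<^sup>2) * \<nu> + g2 * \<nu>\<^sup>2 = e'\<^sup>2 * \<nu>\<^sup>2 + f * e' * \<nu>"
            by (intro bexI[of _ e]) (simp_all add: e add.commute)
        qed
        finally show ?thesis .
      qed
      obtain l where l: "l \<in> F" "l\<^sup>2 = g1 + f * e" using F_square_root[of "g1 + f * e"] f g e by auto
      show ?thesis
        by (rule ex1I[of _ l]) (use on l square_inj in metis)+
    qed
    then show ?thesis unfolding transversal_def using v2 by blast
  qed
qed

text \<open>When \<open>d = 0\<close> throughout, \<open>C\<close> is the unique square root of
  \<open>A * B\<close>, and moving along \<open>(0, 0, 1, 0)\<close> shifts \<open>s\<close> to any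
  value. It remains to see that \<open>W\<close> contains this vector.\<close>

lemma transversal_nucleus:
  assumes W: "isotropic W" and card_W: "card W = q ^ 3"
    and d0: "\<And>A B s d. (A, B, s, d) \<in> W \<Longrightarrow> d = 0"
  shows "\<exists>r. transversal r W"
proof -
  have "\<exists>s. s \<noteq> 0 \<and> (0, 0, s, 0) \<in> W"
  proof (rule ccontr)
    assume "\<not> ?thesis"
    then have no_s: "s = 0" if "(0, 0, s, 0) \<in> W" for s using that by blast
    have s_eq: "s = s'" if "(A, B, s, 0) \<in> W" "(A, B, s', 0) \<in> W" for A B s s'
      using no_s[of "s + s'"] isotropic_add'[OF W that] by simp
    \<comment> \<open>By pigeonhole the projection of \<open>W\<close> to \<open>(A, B)\<close> contains a \<open>GF(q\<^sup>2)\<close>-line, and nothing outside it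
      is perpendicular to that line.\<close>
    let ?h = "\<lambda>((A, B, s, d), (A', B', s', d')). (A + \<omega> * A', B + \<omega> * B')"
    have "\<not> inj_on ?h (W \<times> W)"
    proof
      assume "inj_on ?h (W \<times> W)"
      then have "card (W \<times> W) \<le> card (UNIV :: ('a \<times> 'a) set)"
        by (intro card_inj_on_le[of ?h]) auto
      then have "q ^ 6 \<le> q ^ 4"
        by (simp add: card_cartesian_product card_W card_field flip: UNIV_Times_UNIV power_add)
      then show False using q_gt_1 by (simp add: power_increasing_iff)
    qed
    then obtain w w' v v' where w: "w \<in> W" "w' \<in> W" "v \<in> W" "v' \<in> W"
      and h: "?h (w, w') = ?h (v, v')" and ne: "(w, w') \<noteq> (v, v')"
      unfolding inj_on_def by blast
    have coords: "\<exists>A B s. x = (A, B, s, 0)" if "x \<in> W" for x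
      using d0 that by (metis surj_pair)
    obtain A B s A' B' s' where AB: "w = (A, B, s, 0)" "w' = (A', B', s', 0)"
      using coords w by metis
    obtain C D u C' D' u' where CD: "v = (C, D, u, 0)" "v' = (C', D', u', 0)"
      using coords w by metis
    note mem = w(1)[unfolded AB] w(2)[unfolded AB] w(3)[unfolded CD] w(4)[unfolded CD]
    have eq: "A + \<omega> * A' = C + \<omega> * C'" "B + \<omega> * B' = D + \<omega> * D'"
      using h by (simp_all add: AB CD)
    define a b where "a = A' + C'" and "b = B' + D'"
    have ab: "A + C = \<omega> * a" "B + D = \<omega> * b"
    proof -
      have "A + C = (A + \<omega> * A') + (C + \<omega> * C') + \<omega> * a"
        by (simp add: a_def algebra_simps)
      then show "A + C = \<omega> * a" unfolding eq by simp
      have "B + D = (B + \<omega> * B') + (D + \<omega> * D') + \<omega> * b"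
        by (simp add: b_def algebra_simps)
      then show "B + D = \<omega> * b" unfolding eq by simp
    qed
    have nz: "a \<noteq> 0 \<or> b \<noteq> 0"
    proof (rule ccontr)
      assume "\<not> ?thesis"
      then have "A' = C'" "B' = D'" "A = C" "B = D" using ab by (simp_all add: a_def b_def)
      moreover have "s = u" "s' = u'" using calculation s_eq mem by metis+
      ultimately show False using ne by (simp add: AB CD)
    qed
    have w1: "(a, b, s' + u', 0) \<in> W"
      using isotropic_add'[OF W mem(2,4)] by (simp add: a_def b_def)
    have w2: "(\<omega> * a, \<omega> * b, s + u, 0) \<in> W"
      using isotropic_add'[OF W mem(1,3)] ab by simp
    \<comment> \<open>Perpendicularity to \<open>w1\<close> puts the determinant into
      \<open>F \<nu>\<close>; perpendicularity to \<open>w2\<close> puts it into \<open>F\<close>,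
      because \<open>\<omega>\<close> cancels \<open>\<mu>\<close>. These two sets meet only in
      0.\<close>
    have det0: "a * Y = X * b" if "(X, Y, z, 0) \<in> W" for X Y z
    proof -
      have "tr (\<mu> * (a * Y + X * b)) = 0"
        using isotropic_form[OF W w1 that] by (simp add: form_simp)
      then obtain f where f: "f \<in> F" "a * Y + X * b = f * \<nu>" using tr_mu_eq_0 by blast
      have "tr (\<mu> * (\<omega> * a * Y + X * (\<omega> * b))) = 0"
        using isotropic_form[OF W w2 that] by (simp add: form_simp)
      moreover have "\<mu> * (\<omega> * a * Y + X * (\<omega> * b)) = a * Y + X * b"
        by (simp add: \<mu>_def field_simps)
      ultimately have "f * \<nu> \<in> F" using f by (simp add: tr_eq_0_iff)
      then have "f = 0"
        using f(1) nu_not_in_F by (metis F_divide nonzero_mult_div_cancel_left)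
      then show ?thesis using f(2) by simp
    qed
    \<comment> \<open>All of \<open>W\<close> projects into the line spanned by
      \<open>(a, b)\<close>, and \<open>s\<close> is a function of \<open>(A, B)\<close>, so one
      coordinate determines the vector. This leaves at most \<open>q^2\<close> vectors instead of
      \<open>q^3\<close>.\<close>
    have "card W \<le> card (UNIV :: 'a set)"
    proof (cases "a = 0")
      case True
      have "inj_on (\<lambda>(A, B, s, d). B) W"
      proof (rule inj_onI)
        fix w w' assume w: "w \<in> W" "w' \<in> W" and eq: "(\<lambda>(A, B, s, d). B) w = (\<lambda>(A, B, s, d). B) w'"
        obtain A B s A' B' s' where m: "w = (A, B, s, 0)" "w' = (A', B', s', 0)"
          using coords w by metis
        have "B = B'" using eq m by simp
        moreover from this have "A = A'" using det0 w m nz True by (metis mult_cancel_right)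
        ultimately show "w = w'" using s_eq w m by metis
      qed
      then show ?thesis by (rule card_inj_on_le) auto
    next
      case False
      have "inj_on (\<lambda>(A, B, s, d). A) W"
      proof (rule inj_onI)
        fix w w' assume w: "w \<in> W" "w' \<in> W" and eq: "(\<lambda>(A, B, s, d). A) w = (\<lambda>(A, B, s, d). A) w'"
        obtain A B s A' B' s' where m: "w = (A, B, s, 0)" "w' = (A', B', s', 0)"
          using coords w by metis
        have "A = A'" using eq m by simp
        moreover from this have "B = B'" using det0 w m False by (metis mult_cancel_left)
        ultimately show "w = w'" using s_eq w m by metis
      qed
      then show ?thesis by (rule card_inj_on_le) auto
    qed
    then show False using q_gt_1 by (simp add: card_W card_field)
  qed
  then obtain s0 where s0: "s0 \<noteq> 0" "(0, 0, s0, 0) \<in> W" by blast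
  then have "(0, 0, 1, 0) \<in> W"
    using isotropic_scale'[OF W, of "1 / s0" 0 0 s0 0] isotropic_F[OF W s0(2)] by simp
  moreover have "\<exists>!t. t \<in> F \<and> on_O (w + scale t (0, 0, 1, 0))" if "w \<in> W" for w
  proof -
    obtain A B s where w: "w = (A, B, s, 0)" using d0 \<open>w \<in> W\<close> by (metis surj_pair)
    have s: "s \<in> F" using isotropic_F[OF W] that w by blast
    obtain C where C: "C\<^sup>2 = A * B" using square_root_exists by blast
    have "on_O (w + scale t (0, 0, 1, 0)) \<longleftrightarrow> t = s + tr (\<mu> * C)" for t
    proof -
      have "on_O (w + scale t (0, 0, 1, 0)) \<longleftrightarrow> tr (\<mu> * C) = s + t"
        by (simp add: w on_O_simp square_inj flip: C)
      then show ?thesis by (metis add_left_self)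
    qed
    then show ?thesis using s by auto
  qed
  ultimately show ?thesis unfolding transversal_def by blast
qed

text \<open>Three cases: no affine point; an affine point and two directions with nonzero
  determinant; an affine point and all directions proportional over \<open>GF(q^2)\<close>.\<close>

lemma transversal_exists:
  assumes W: "isotropic W" and card_W: "card W = q ^ 3"
  shows "\<exists>r. transversal r W"
proof (cases "\<forall>A B s d. (A, B, s, d) \<in> W \<longrightarrow> d = 0")
  case True
  then show ?thesis using transversal_nucleus[OF W card_W] by blast
next
  case False
  then obtain A B s d where d: "(A, B, s, d) \<in> W" "d \<noteq> 0" by blast
  define A0 B0 s0 where "A0 = 1 / d * A" and "B0 = 1 / d * B" and "s0 = 1 / d * s"
  have p: "(A0, B0, s0, 1) \<in> W"
    using isotropic_scale'[OF W _ d(1), of "1 / d"] isotropic_F[OF W d(1)] d(2)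
    by (simp add: A0_def B0_def s0_def)
  show ?thesis
  proof (cases "\<exists>A1 B1 s1 A2 B2 s2. (A1, B1, s1, 0) \<in> W \<and> (A2, B2, s2, 0) \<in> W \<and> A1 * B2 + A2 * B1 \<noteq> 0")
    case True
    then show ?thesis using transversal_det_nonzero[OF W p] by blast
  next
    case False
    then have det0: "A1 * B2 = A2 * B1" if "(A1, B1, s1, 0) \<in> W" "(A2, B2, s2, 0) \<in> W"
      for A1 B1 s1 A2 B2 s2 using that unfolding add_eq_0_char2 by blast
    \<comment> \<open>A vector of \<open>W\<close> is determined by \<open>d\<close> and the
      projection of its direction, so \<open>L\<close> has at least \<open>q^2\<close> elements;
      being contained in a \<open>GF(q^2)\<close>-line, it equals that line.\<close>
    define L where "L = {(A, B). \<exists>s. (A, B, s, 0) \<in> W}"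
    let ?h = "\<lambda>((A, B), f). (A + f * A0, B + f * B0, tr (\<mu> * (A0 * B + A * B0)) + f * s0, f)"
    have "W \<subseteq> ?h ` (L \<times> F)"
    proof
      fix w assume "w \<in> W"
      then obtain A B f where f: "f \<in> F" and v: "(A, B, tr (\<mu> * (A0 * B + A * B0)), 0) \<in> W"
        and w: "w = (A + f * A0, B + f * B0, tr (\<mu> * (A0 * B + A * B0)) + f * s0, f)"
        using isotropic_decompose[OF W p] by metis
      have "((A, B), f) \<in> L \<times> F" using f v by (auto simp: L_def)
      then show "w \<in> ?h ` (L \<times> F)" by (rule rev_image_eqI) (simp add: w)
    qed
    then have "card W \<le> card (L \<times> F)" by (rule surj_card_le[rotated]) simp
    then have "q * q\<^sup>2 \<le> q * card L"
      by (simp add: card_W card_cartesian_product card_F power2_eq_square power3_eq_cube mult_ac)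
    then have card_L: "q\<^sup>2 \<le> card L" using q_pos by simp
    have "\<not> L \<subseteq> {(0, 0)}"
    proof
      assume "L \<subseteq> {(0, 0)}"
      then have "card L \<le> 1" using card_mono[of "{(0, 0)}" L] by simp
      then show False using card_L q_gt_1 one_less_power[of q 2] by simp
    qed
    then obtain A1 B1 where v1: "(A1, B1) \<in> L" and nz: "A1 \<noteq> 0 \<or> B1 \<noteq> 0" by auto
    have det1: "A * B1 = A1 * B" if "(A, B) \<in> L" for A B
      using that v1 det0 unfolding L_def by blast
    have line: "(x * A1, x * B1) \<in> L" for x
    proof -
      let ?M = "range (\<lambda>x. (x * A1, x * B1))"
      have "L \<subseteq> ?M"
      proof clarify
        fix A B assume "(A, B) \<in> L"
        note det1[OF this]
        then have "(A, B) = (A / A1 * A1, A / A1 * B1) \<or> (A, B) = (B / B1 * A1, B / B1 * B1)"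
          using nz by (cases "A1 = 0") (simp_all add: field_simps)
        then show "(A, B) \<in> ?M" by blast
      qed
      moreover have "card ?M \<le> card L"
        using card_image_le[of UNIV "\<lambda>x. (x * A1, x * B1)"] card_L card_field by simp
      ultimately have "L = ?M" by (intro card_seteq) auto
      then show ?thesis by blast
    qed
    \<comment> \<open>The affine point may be moved along the full line \<open>L\<close> until one
      of its first two coordinates vanishes, as \<open>transversal_line\<close> demands.\<close>
    obtain x where x: "(A0 + x * A1) * (B0 + x * B1) = 0"
    proof (cases "A1 = 0")
      case True
      then show ?thesis using nz by (intro that[of "B0 / B1"]) simp
    next
      case False
      then show ?thesis by (intro that[of "A0 / A1"]) simp
    qed
    obtain s1 where "(x * A1, x * B1, s1, 0) \<in> W" using line[of x] by (auto simp: L_def)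
    then have p': "(A0 + x * A1, B0 + x * B1, s0 + s1, 1) \<in> W"
      using isotropic_add'[OF W p] by fastforce
    show ?thesis
      by (rule transversal_line[OF W p' x _ _ nz]) (use line det1 in \<open>auto simp: L_def\<close>)
  qed
qed

text \<open>Double counting of the pairs \<open>(w, t)\<close> with \<open>w + scale t r\<close> on
  the conic: transversality gives \<open>q^3\<close> pairs, while sorting by the translated vector
  gives \<open>q\<close> pairs for each solution.\<close>

lemma card_on_O_isotropic:
  assumes W: "isotropic W" and card_W: "card W = q ^ 3"
  shows "card {w \<in> W. on_O w} = q\<^sup>2"
proof -
  obtain r where r: "r \<in> W" "\<And>w. w \<in> W \<Longrightarrow> \<exists>!t. t \<in> F \<and> on_O (w + scale t r)"
    using transversal_exists[OF W card_W] unfolding transversal_def by blast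
  let ?Z = "{w \<in> W. on_O w}"
  let ?T = "{(w, t). w \<in> W \<and> t \<in> F \<and> on_O (w + scale t r)}"
  have self: "v + v = 0" for v :: "'a \<times> 'a \<times> 'a \<times> 'a" by (cases v) (simp add: zero_prod_def)
  then have cancel: "w + v + v = w" for w v :: "'a \<times> 'a \<times> 'a \<times> 'a" by (simp add: add.assoc)
  have "bij_betw fst ?T W"
    unfolding bij_betw_def inj_on_def using r(2) by (auto simp: image_iff) blast+
  then have "card ?T = q ^ 3" using bij_betw_same_card card_W by fastforce
  \<comment> \<open>In characteristic 2 the translation is its own inverse.\<close>
  moreover have "bij_betw (\<lambda>(w, t). (w + scale t r, t)) ?T (?Z \<times> F)"
    by (rule bij_betwI[of _ _ _ "\<lambda>(w, t). (w + scale t r, t)"])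
      (use r(1) in \<open>auto simp: cancel isotropic_add[OF W] isotropic_scale[OF W]\<close>)
  then have "card ?T = card (?Z \<times> F)" by (rule bij_betw_same_card)
  ultimately have "card ?Z * q = q\<^sup>2 * q"
    by (simp only: card_cartesian_product card_F power3_eq_cube power2_eq_square)
  then show ?thesis using q_pos by simp
qed

section \<open>The Baer subgeometry and the ovoid\<close>

text \<open>The first summand is the third coordinate of \<open>S_gamma\<close>, the second is the
  summand \<open>1 / \<omega> ^ (q + 1)\<close> of the matrix entry in row 3, column 6. Subtracting
  both leaves a pure weighted trace on the orbit.\<close>

definition \<kappa> :: 'a where "\<kappa> = tr (cj \<omega> * \<gamma> * \<mu>) + \<mu> * \<nu>"

text \<open>The inverse of the coordinate change described at the beginning.\<close>

definition emb :: "'a \<times> 'a \<times> 'a \<times> 'a \<Rightarrow> nat \<Rightarrow> 'a" where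
  "emb = (\<lambda>(A, B, s, d). mk6 (\<mu> * A) (cj (\<mu> * A)) (s + \<kappa> * d)
     (cj (\<mu> * (B + cj \<omega> * d))) (\<mu> * (B + cj \<omega> * d)) d)"

definition pt :: "'a \<times> 'a \<times> 'a \<times> 'a \<Rightarrow> (nat \<Rightarrow> 'a) set" where
  "pt w = proj_pt (emb w)"

lemma emb_simp: "emb (A, B, s, d) = mk6 (\<mu> * A) (cj (\<mu> * A)) (s + \<kappa> * d)
     (cj (\<mu> * (B + cj \<omega> * d))) (\<mu> * (B + cj \<omega> * d)) d"
  by (simp add: emb_def)

lemma kappa_in_F [simp]: "\<kappa> \<in> F"
  by (simp add: \<kappa>_def)

lemma V_simp: "(A, B, s, d) \<in> V \<longleftrightarrow> s \<in> F \<and> d \<in> F"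
  by (simp add: V_def)

lemma emb_inj: "emb w = emb w' \<longleftrightarrow> w = w'"
proof
  assume eq: "emb w = emb w'"
  obtain A B s d where w: "w = (A, B, s, d)" by (cases w)
  obtain A' B' s' d' where w': "w' = (A', B', s', d')" by (cases w')
  show "w = w'" using eq unfolding w w' emb_simp mk6_eq_iff by (simp, elim conjE, simp)
qed simp

lemma emb_0: "emb 0 = (\<lambda>i. 0)"
proof -
  have "emb 0 = mk6 0 0 0 0 0 0" by (simp add: zero_prod_def emb_simp)
  then show ?thesis by (simp only: mk6_0)
qed

lemma emb_eq_0_iff: "emb w = (\<lambda>i. 0) \<longleftrightarrow> w = 0"
  using emb_inj[of w 0] by (simp only: emb_0)

lemma emb_add: "emb (w + w') = (\<lambda>i. emb w i + emb w' i)"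
  by (cases w; cases w') (simp add: emb_simp mk6_add algebra_simps)

lemma emb_scale: "f \<in> F \<Longrightarrow> emb (scale f w) = (\<lambda>i. f * emb w i)"
  by (cases w) (simp add: emb_simp mk6_scale algebra_simps F_iff)

lemma sigma_vecs_eq: "sigma_vecs q = emb ` V"
proof (intro equalityI subsetI)
  fix v :: "nat \<Rightarrow> 'a" assume "v \<in> sigma_vecs q"
  then obtain \<alpha> \<beta> \<delta>0 \<delta>1 where v: "v = mk6 \<alpha> (cj \<alpha>) \<delta>0 \<beta> (cj \<beta>) \<delta>1" "\<delta>0 \<in> F" "\<delta>1 \<in> F"
    by (auto simp: sigma_vecs_def cj_def F_def)
  have "v = emb (\<omega> * \<alpha>, \<omega> * cj \<beta> + cj \<omega> * \<delta>1, \<delta>0 + \<kappa> * \<delta>1, \<delta>1)"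
    by (simp add: emb_simp v mk6_eq_iff \<mu>_def \<nu>_def add.assoc)
  then show "v \<in> emb ` V" using v by (auto simp: V_simp)
next
  fix v assume "v \<in> emb ` V"
  then obtain A B s d where "v = emb (A, B, s, d)" "s \<in> F" "d \<in> F" by (auto simp: V_def)
  then have "v = mk6 (\<mu> * A) ((\<mu> * A) ^ q) (s + \<kappa> * d) (cj (\<mu> * (B + cj \<omega> * d)))
      ((cj (\<mu> * (B + cj \<omega> * d))) ^ q) d \<and> s + \<kappa> * d \<in> subF q \<and> d \<in> subF q"
    unfolding emb_simp F_def[symmetric] by (simp flip: cj_def)
  then show "v \<in> sigma_vecs q" unfolding sigma_vecs_def by blast
qed

lemma Sigma_pts_eq: "Sigma_pts q = pt ` (V - {0})"
proof -
  have "{proj_pt v | v. v \<in> emb ` V \<and> v \<noteq> (\<lambda>i. 0)} = {pt w | w. w \<in> V \<and> emb w \<noteq> (\<lambda>i. 0)}"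
    unfolding pt_def by blast
  then show ?thesis unfolding Sigma_pts_def sigma_vecs_eq emb_eq_0_iff by blast
qed

text \<open>The terms of \<open>herm\<close> come in conjugate pairs that combine to traces, and
  \<open>\<kappa> * d * d'\<close> occurs twice and cancels.\<close>

lemma herm_emb:
  assumes "w \<in> V" "w' \<in> V"
  shows "herm q \<omega> (emb w) (emb w') = form w w'"
proof -
  obtain A B s d where w: "w = (A, B, s, d)" by (cases w)
  obtain A' B' s' d' where w': "w' = (A', B', s', d')" by (cases w')
  have F: "cj s = s" "cj d = d" "cj s' = s'" "cj d' = d'" "cj \<kappa> = \<kappa>"
    using assms kappa_in_F by (simp_all add: w w' V_simp F_iff del: kappa_in_F)
  define a b a' b' where "a = \<mu> * A" and "b = \<mu> * (B + cj \<omega> * d)"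
    and "a' = \<mu> * A'" and "b' = \<mu> * (B' + cj \<omega> * d')"
  then have B: "B = \<omega> * b + cj \<omega> * d" "B' = \<omega> * b' + cj \<omega> * d'"
    by (simp_all add: \<mu>_def add.assoc)
  have e: "emb w = mk6 a (cj a) (s + \<kappa> * d) (cj b) b d" "emb w' = mk6 a' (cj a') (s' + \<kappa> * d') (cj b') b' d'"
    unfolding w w' emb_simp a_def b_def a'_def b'_def by simp_all
  have "\<mu> * (A * B' + A' * B) = a * B' + a' * B"
    by (simp add: a_def a'_def algebra_simps)
  then have "form w w' = tr (a * (\<omega> * b' + cj \<omega> * d') + a' * (\<omega> * b + cj \<omega> * d)) + s * d' + s' * d"
    by (simp only: w w' form_simp B)
  then show ?thesis
    unfolding herm_def cj_def[symmetric] e tr_def by (simp add: F algebra_simps)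
qed

section \<open>Points as classes of vectors proportional over \<open>F\<close>\<close>

lemma pt_eq_iff:
  assumes "w \<in> V" "w' \<in> V" "w \<noteq> 0"
  shows "pt w = pt w' \<longleftrightarrow> (\<exists>f\<in>F - {0}. w' = scale f w)"
proof
  assume "pt w = pt w'"
  moreover have "emb w' \<in> pt w'" unfolding pt_def proj_pt_def by (auto intro!: exI[of _ 1])
  ultimately obtain c where c: "c \<noteq> 0" "emb w' = (\<lambda>i. c * emb w i)"
    unfolding pt_def proj_pt_def by auto
  \<comment> \<open>The factor \<open>c\<close> multiplies some nonzero coordinate and also its
    conjugate, hence \<open>c\<close> is fixed by \<open>cj\<close>.\<close>
  have "c \<in> F"
  proof -
    obtain A B s d where w: "w = (A, B, s, d)" by (cases w)
    obtain A' B' s' d' where w': "w' = (A', B', s', d')" by (cases w')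
    have F: "cj (s + \<kappa> * d) = s + \<kappa> * d" "cj d = d" "cj (s' + \<kappa> * d') = s' + \<kappa> * d'" "cj d' = d'"
      using assms(1,2) kappa_in_F by (simp_all add: w w' V_simp F_iff del: kappa_in_F)
    define x y z where "x = \<mu> * A" and "y = \<mu> * (B + cj \<omega> * d)" and "z = s + \<kappa> * d"
    define x' y' z' where "x' = \<mu> * A'" and "y' = \<mu> * (B' + cj \<omega> * d')" and "z' = s' + \<kappa> * d'"
    have eqs: "x' = c * x" "cj x' = c * cj x" "z' = c * z" "cj y' = c * cj y" "y' = c * y" "d' = c * d"
      using c(2) unfolding w w' emb_simp mk6_scale mk6_eq_iff x_def y_def z_def x'_def y'_def z'_def by blast+
    have *: "c \<in> F" if "u \<noteq> 0" "u' = c * u" "cj u' = c * cj u" for u u'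
      using that by (simp add: F_iff)
    have "x \<noteq> 0 \<or> y \<noteq> 0 \<or> z \<noteq> 0 \<or> d \<noteq> 0"
      using assms(3) unfolding w x_def y_def z_def zero_prod_def by auto
    then show ?thesis
      using *[of x x'] *[of y y'] *[of z z'] *[of d d'] eqs F unfolding z_def z'_def by metis
  qed
  moreover have "w' = scale c w" using c(2) emb_scale[OF \<open>c \<in> F\<close>] emb_inj by metis
  ultimately show "\<exists>f\<in>F - {0}. w' = scale f w" using c(1) by blast
next
  assume "\<exists>f\<in>F - {0}. w' = scale f w"
  then obtain f where f: "f \<in> F" "f \<noteq> 0" "w' = scale f w" by blast
  have e: "emb w' = (\<lambda>i. f * emb w i)" using f emb_scale by simp
  show "pt w = pt w'"
    unfolding pt_def proj_pt_def e
  proof (intro equalityI subsetI; clarify)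
    fix c :: 'a assume "c \<noteq> 0"
    then show "\<exists>c'. (\<lambda>i. c * emb w i) = (\<lambda>i. c' * (f * emb w i)) \<and> c' \<noteq> 0"
      using f(2) by (intro exI[of _ "c / f"]) auto
  next
    fix c :: 'a assume "c \<noteq> 0"
    then show "\<exists>c'. (\<lambda>i. c * (f * emb w i)) = (\<lambda>i. c' * emb w i) \<and> c' \<noteq> 0"
      using f(2) by (intro exI[of _ "c * f"]) (auto simp: mult.assoc)
  qed
qed

text \<open>Each point is represented by exactly \<open>q - 1\<close> vectors of
  \<open>V\<close>.\<close>

lemma card_pt_image:
  assumes X: "X \<subseteq> V - {0}" and closed: "\<And>f w. f \<in> F - {0} \<Longrightarrow> w \<in> X \<Longrightarrow> scale f w \<in> X"
  shows "card (pt ` X) * (q - 1) = card X"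
proof -
  have fin: "finite X" by simp
  have fibre: "card {w \<in> X. pt w = y} = q - 1" if y: "y \<in> pt ` X" for y
  proof -
    obtain w where w: "w \<in> X" "y = pt w" using y by blast
    have "{w' \<in> X. pt w' = y} = (\<lambda>f. scale f w) ` (F - {0})"
      using pt_eq_iff[of w] w X closed by blast
    moreover have "inj_on (\<lambda>f. scale f w) (F - {0})"
      using w X by (cases w) (auto simp: inj_on_def zero_prod_def)
    ultimately show ?thesis by (simp add: card_image card_F)
  qed
  have "card X = (\<Sum>y\<in>pt ` X. card {w \<in> X. pt w = y})"
    by (subst card_eq_sum, subst sum.image_gen[OF fin, of _ pt]) simp
  also have "\<dots> = card (pt ` X) * (q - 1)" by (simp add: fibre)
  finally show ?thesis ..
qed

lemma V_scale: "f \<in> F \<Longrightarrow> w \<in> V \<Longrightarrow> scale f w \<in> V"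
  by (cases w) (simp add: V_simp)

lemma scale_eq_0_iff: "scale f w = 0 \<longleftrightarrow> f = 0 \<or> w = 0"
  by (cases w) (auto simp: zero_prod_def)

section \<open>The quadric and the orbit as the parts \<open>d = 0\<close> and
  \<open>d \<noteq> 0\<close> of one set\<close>

lemma on_O_scale:
  assumes "f \<in> F" "on_O w"
  shows "on_O (scale f w)"
proof -
  obtain A B s d where w: "w = (A, B, s, d)" by (cases w)
  obtain C where C: "A * B = C\<^sup>2 + d * C + d\<^sup>2 * \<gamma>" "tr (\<mu> * C) = s"
    using assms(2) by (auto simp: w on_O_simp)
  have "(f * A) * (f * B) = f\<^sup>2 * (A * B)" by (simp add: power2_eq_square)
  also have "\<dots> = (f * C)\<^sup>2 + (f * d) * (f * C) + (f * d)\<^sup>2 * \<gamma>"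
    unfolding C(1) by (simp add: power2_eq_square algebra_simps)
  finally have "(f * A) * (f * B) = (f * C)\<^sup>2 + (f * d) * (f * C) + (f * d)\<^sup>2 * \<gamma>" .
  moreover have "tr (\<mu> * (f * C)) = f * s"
    using tr_scale[OF assms(1), of "\<mu> * C"] C(2) by (simp add: mult_ac)
  ultimately show ?thesis 
    unfolding w scale_simp on_O_simp by (intro exI[of _ "f * C"] conjI)
qed

text \<open>For \<open>d = 0\<close>, \<open>C\<close> is the square root of \<open>A * B\<close>,
  and the quadric equation is the square of the condition \<open>s = tr (\<mu> * C)\<close>.\<close>

lemma Q_pts_eq: "Q_pts q = pt ` {w \<in> V - {0}. on_O w \<and> snd (snd (snd w)) = 0}"
proof -
  have "(\<exists>v\<in>pt w. v 6 = 0 \<and> (v 3)\<^sup>2 + v 1 * v 5 + v 2 * v 4 = 0) \<longleftrightarrow> on_O w \<and> snd (snd (snd w)) = 0"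
    if "w \<in> V" for w
  proof -
    obtain A B s d where w: "w = (A, B, s, d)" by (cases w)
    obtain C where C: "C\<^sup>2 = A * B" using square_root_exists by blast
    have "(\<mu> * C)\<^sup>2 = (\<mu> * A) * (\<mu> * B)"
      by (simp add: power_mult_distrib C) (simp add: power2_eq_square)
    then have "(tr (\<mu> * C))\<^sup>2 = tr ((\<mu> * A) * (\<mu> * B))"
      by (simp only: tr_square[symmetric])
    also have "\<dots> = (\<mu> * A) * (\<mu> * B) + cj (\<mu> * A) * cj (\<mu> * B)"
      by (simp only: tr_def cj_mult)
    finally have sq: "(tr (\<mu> * C))\<^sup>2 = \<dots>" .
    have quadric: "(emb w 3)\<^sup>2 + emb w 1 * emb w 5 + emb w 2 * emb w 4 = s\<^sup>2 + (tr (\<mu> * C))\<^sup>2" if "d = 0"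
      unfolding sq using that by (simp add: w emb_simp add.assoc)
    have "(\<exists>v\<in>pt w. v 6 = 0 \<and> (v 3)\<^sup>2 + v 1 * v 5 + v 2 * v 4 = 0) \<longleftrightarrow>
      (\<exists>c. c \<noteq> 0 \<and> c * d = 0 \<and> c\<^sup>2 * ((emb w 3)\<^sup>2 + emb w 1 * emb w 5 + emb w 2 * emb w 4) = 0)"
    proof -
      have mem_pt: "(\<exists>v\<in>pt w. R v) \<longleftrightarrow> (\<exists>c. c \<noteq> 0 \<and> R (\<lambda>i. c * emb w i))" for R
        by (auto simp: pt_def proj_pt_def)
      have d6: "emb w 6 = d" by (simp add: w emb_simp)
      have hom: "(c * emb w 3)\<^sup>2 + c * emb w 1 * (c * emb w 5) + c * emb w 2 * (c * emb w 4)
        = c\<^sup>2 * ((emb w 3)\<^sup>2 + emb w 1 * emb w 5 + emb w 2 * emb w 4)" for c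
        by (simp add: power2_eq_square algebra_simps)
      have "(\<exists>v\<in>pt w. v 6 = 0 \<and> (v 3)\<^sup>2 + v 1 * v 5 + v 2 * v 4 = 0) \<longleftrightarrow>
        (\<exists>c. c \<noteq> 0 \<and> c * emb w 6 = 0 \<and>
          (c * emb w 3)\<^sup>2 + c * emb w 1 * (c * emb w 5) + c * emb w 2 * (c * emb w 4) = 0)"
        by (rule mem_pt)
      then show ?thesis by (simp only: d6 hom)
    qed
    also have "\<dots> \<longleftrightarrow> d = 0 \<and> (emb w 3)\<^sup>2 + emb w 1 * emb w 5 + emb w 2 * emb w 4 = 0"
      by (auto intro: exI[of _ 1])
    also have "\<dots> \<longleftrightarrow> d = 0 \<and> s = tr (\<mu> * C)"
      using quadric by (auto simp: square_inj)
    also have "\<dots> \<longleftrightarrow> on_O w \<and> snd (snd (snd w)) = 0"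
      by (auto simp: w on_O_simp square_inj simp flip: C)
    finally show ?thesis .
  qed
  then show ?thesis unfolding Q_pts_def Sigma_pts_eq by blast
qed

lemma orbit_vector:
  "mat_app (Mmat q \<omega> a b c d) (S_gamma q \<omega> \<gamma>) =
    emb (\<gamma> * a\<^sup>2 + a * c + c\<^sup>2, \<gamma> * b\<^sup>2 + b * d + d\<^sup>2, tr (\<mu> * (\<gamma> * a * b + c * d + a * d)), 1)"
proof -
  have six: "{Suc 0..6} = {1, 2, 3, 4, 5, 6}" by auto
  have mat_app_mk6: "mat_app M x = mk6 (\<Sum>j=1..6. M 1 j * x j) (\<Sum>j=1..6. M 2 j * x j) (\<Sum>j=1..6. M 3 j * x j)
     (\<Sum>j=1..6. M 4 j * x j) (\<Sum>j=1..6. M 5 j * x j) (\<Sum>j=1..6. M 6 j * x j)" for M and x :: "nat \<Rightarrow> 'a"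
    unfolding mat_app_def mk6_def by (rule ext) (auto simp: six)
  have pow: "x ^ (2 * q) = (cj x)\<^sup>2" "x ^ (q + 1) = x * cj x" for x :: 'a
    by (simp_all add: cj_def power_mult[symmetric] mult.commute)
  have om: "1 / \<omega> = \<mu>" "1 / cj \<omega> = \<nu>" "x / \<omega> = x * \<mu>" "x / cj \<omega> = x * \<nu>" "x / (\<omega> * cj \<omega>) = x * (\<mu> * \<nu>)" for x
    by (simp_all add: \<mu>_def \<nu>_def)
  have om1: "\<omega> * \<mu> = 1" "cj \<omega> * \<nu> = 1" by (simp_all add: \<mu>_def \<nu>_def)
  \<comment> \<open>Writing \<open>c^2\<close> as \<open>c^2 * (\<omega> * \<mu>)\<close> lets
    \<open>\<omega> + cj \<omega> = 1\<close> merge the two terms in \<open>c^2\<close>. Rows 2 and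
    4 are the conjugates of rows 1 and 5.\<close>
  have row1: "a\<^sup>2 * (\<gamma> * \<mu>) + c\<^sup>2 + c * (a + c * cj \<omega>) * \<mu> = \<mu> * (\<gamma> * a\<^sup>2 + a * c + c\<^sup>2)" for a c
  proof -
    have "a\<^sup>2 * (\<gamma> * \<mu>) + c\<^sup>2 * (\<omega> * \<mu>) + c * (a + c * cj \<omega>) * \<mu> = \<mu> * (\<gamma> * a\<^sup>2 + a * c + c\<^sup>2)"
      by (simp add: cj_omega algebra_simps power2_eq_square)
    then show ?thesis by (simp add: om1)
  qed
  have row5: "b\<^sup>2 * (\<gamma> * \<mu>) + d\<^sup>2 + (d * (b + d * cj \<omega>) + cj \<omega>) * \<mu> = \<mu> * ((\<gamma> * b\<^sup>2 + b * d + d\<^sup>2) + cj \<omega>)"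
    using row1[of b d] by (simp add: algebra_simps)
  have row3: "a * b * (\<gamma> * \<mu>) + c * d + d * (a + c * cj \<omega>) * \<mu> = \<mu> * (\<gamma> * a * b + c * d + a * d)"
  proof -
    have "a * b * (\<gamma> * \<mu>) + c * d * (\<omega> * \<mu>) + d * (a + c * cj \<omega>) * \<mu> = \<mu> * (\<gamma> * a * b + c * d + a * d)"
      by (simp add: cj_omega algebra_simps)
    then show ?thesis by (simp add: om1)
  qed
  have sum6: "(\<Sum>j=1..6. f j) = f 1 + f 2 + f 3 + f 4 + f 5 + f 6" for f :: "nat \<Rightarrow> 'a"
    by (simp add: six add.assoc)
  note rows = Mmat_def S_gamma_def
  have r1: "(\<Sum>j=1..6. Mmat q \<omega> a b c d 1 j * S_gamma q \<omega> \<gamma> j) = \<mu> * (\<gamma> * a\<^sup>2 + a * c + c\<^sup>2)"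
    unfolding sum6 row1[symmetric] by (simp add: rows om add.assoc flip: cj_def)
  have r2: "(\<Sum>j=1..6. Mmat q \<omega> a b c d 2 j * S_gamma q \<omega> \<gamma> j) = cj (\<mu> * (\<gamma> * a\<^sup>2 + a * c + c\<^sup>2))"
    unfolding sum6 row1[symmetric] by (simp add: rows pow om add.assoc flip: cj_def)
  have r5: "(\<Sum>j=1..6. Mmat q \<omega> a b c d 5 j * S_gamma q \<omega> \<gamma> j) = \<mu> * ((\<gamma> * b\<^sup>2 + b * d + d\<^sup>2) + cj \<omega>)"
    unfolding sum6 row5[symmetric] by (simp add: rows om add.assoc flip: cj_def)
  have r4: "(\<Sum>j=1..6. Mmat q \<omega> a b c d 4 j * S_gamma q \<omega> \<gamma> j) = cj (\<mu> * ((\<gamma> * b\<^sup>2 + b * d + d\<^sup>2) + cj \<omega>))"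
    unfolding sum6 row5[symmetric] by (simp add: rows pow om add.assoc flip: cj_def)
  have r3: "(\<Sum>j=1..6. Mmat q \<omega> a b c d 3 j * S_gamma q \<omega> \<gamma> j) = tr (\<mu> * (\<gamma> * a * b + c * d + a * d)) + \<kappa>"
    unfolding sum6 row3[symmetric] \<kappa>_def tr_def
    by (simp add: rows pow om flip: cj_def)
  have r6: "(\<Sum>j=1..6. Mmat q \<omega> a b c d 6 j * S_gamma q \<omega> \<gamma> j) = 1"
    unfolding sum6 by (simp add: rows)
  show ?thesis unfolding mat_app_mk6 r1 r2 r3 r4 r5 r6 emb_simp by simp
qed

text \<open>With \<theta> a root of \<open>X^2 + X + \<gamma>\<close> in an extension,
  \<open>\<gamma> * a^2 + a * c + c^2\<close> is the norm of c + a\<theta>. The identity is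
  multiplicativity of the norm: the conjugate of c + a\<theta> times d + b\<theta> is
  \<open>?C\<close> + (ad + bc)\<theta>.\<close>

lemma orbit_on_O:
  assumes "a * d + b * c = 1"
  shows "on_O (\<gamma> * a\<^sup>2 + a * c + c\<^sup>2, \<gamma> * b\<^sup>2 + b * d + d\<^sup>2, tr (\<mu> * (\<gamma> * a * b + c * d + a * d)), 1)"
proof -
  let ?C = "\<gamma> * a * b + c * d + a * d"
  have "(\<gamma> * a\<^sup>2 + a * c + c\<^sup>2) * (\<gamma> * b\<^sup>2 + b * d + d\<^sup>2) =
      ?C\<^sup>2 + (a * d + b * c) * ?C + (a * d + b * c)\<^sup>2 * \<gamma>"
    by (simp add: power2_eq_square algebra_simps)
  then show ?thesis unfolding assms on_O_simp by (intro exI[of _ ?C]) simp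
qed

lemma G_orbit_eq: "G_orbit q \<omega> (S_gamma q \<omega> \<gamma>) = pt ` {w \<in> V - {0}. on_O w \<and> snd (snd (snd w)) \<noteq> 0}"
proof (intro equalityI subsetI)
  fix P assume "P \<in> G_orbit q \<omega> (S_gamma q \<omega> \<gamma>)"
  then obtain a b c d where abcd: "a * d + b * c = 1"
    and P: "P = proj_pt (mat_app (Mmat q \<omega> a b c d) (S_gamma q \<omega> \<gamma>))"
    unfolding G_orbit_def by blast
  let ?w = "(\<gamma> * a\<^sup>2 + a * c + c\<^sup>2, \<gamma> * b\<^sup>2 + b * d + d\<^sup>2, tr (\<mu> * (\<gamma> * a * b + c * d + a * d)), 1)"
  have "P = pt ?w" unfolding P orbit_vector pt_def ..
  moreover have "?w \<in> {w \<in> V - {0}. on_O w \<and> snd (snd (snd w)) \<noteq> 0}"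
    using orbit_on_O[OF abcd] by (simp add: V_simp zero_prod_def)
  ultimately show "P \<in> pt ` {w \<in> V - {0}. on_O w \<and> snd (snd (snd w)) \<noteq> 0}" by blast
next
  fix P assume "P \<in> pt ` {w \<in> V - {0}. on_O w \<and> snd (snd (snd w)) \<noteq> 0}"
  then obtain A' B' s' d' where w': "(A', B', s', d') \<in> V" "(A', B', s', d') \<noteq> 0"
    "on_O (A', B', s', d')" "d' \<noteq> 0" and P: "P = pt (A', B', s', d')" by auto
  have d': "1 / d' \<in> F - {0}" using w' by (simp add: V_simp)
  define A B s where "A = 1 / d' * A'" and "B = 1 / d' * B'" and "s = 1 / d' * s'"
  have w: "scale (1 / d') (A', B', s', d') = (A, B, s, 1)"
    using w'(4) by (simp add: A_def B_def s_def)
  have "on_O (A, B, s, 1)" using on_O_scale[OF _ w'(3), of "1 / d'"] d' w by simp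
  then obtain C where C: "A * B = C\<^sup>2 + C + \<gamma>" "s = tr (\<mu> * C)" by (auto simp: on_O_simp)
  have "(A, B, s, 1) \<in> V" using V_scale[OF _ w'(1), of "1 / d'"] d' w by simp
  then have P': "P = pt (A, B, s, 1)"
    unfolding P using pt_eq_iff[OF w'(1) _ w'(2)] d' w by metis
  have A0: "A \<noteq> 0" using C(1) no_root[of C] by auto
  \<comment> \<open>A group element with \<open>a = 0\<close> suffices because every field element is a square.\<close>
  obtain c where c: "c\<^sup>2 = A" using square_root_exists by blast
  have c0: "c \<noteq> 0" using A0 c by auto
  have B: "B = (\<gamma> + C + C\<^sup>2) / A"
    using A0 C(1) by (simp add: field_simps)
  have "\<gamma> * (1 / c)\<^sup>2 + 1 / c * (C / c) + (C / c)\<^sup>2 = B"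
    unfolding B c[symmetric] using c0 by (simp add: power2_eq_square add_divide_distrib)
  then have "mat_app (Mmat q \<omega> 0 (1 / c) c (C / c)) (S_gamma q \<omega> \<gamma>) = emb (A, B, s, 1)"
    using orbit_vector[of 0 "1 / c" c "C / c"] c0 c C(2) by simp
  then have "P = proj_pt (mat_app (Mmat q \<omega> 0 (1 / c) c (C / c)) (S_gamma q \<omega> \<gamma>))"
    unfolding P' pt_def by simp
  moreover have "0 * (C / c) + 1 / c * c = 1" using c0 by simp
  ultimately show "P \<in> G_orbit q \<omega> (S_gamma q \<omega> \<gamma>)" unfolding G_orbit_def by blast
qed

lemma ovoid_O_eq: "ovoid_O q \<omega> \<gamma> = pt ` {w \<in> V - {0}. on_O w}"
  unfolding ovoid_O_def Q_pts_eq G_orbit_eq by blast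

section \<open>Generators as isotropic planes, and the final counts\<close>

lemma generator_isotropic:
  assumes "g \<in> generators q \<omega>"
  obtains W where "isotropic W" "card W = q ^ 3" "0 \<in> W" "g = pt ` (W - {0})"
proof -
  obtain u1 u2 u3 where g: "g = {proj_pt w | w. w \<in> fq_span q u1 u2 u3 \<and> w \<noteq> (\<lambda>i. 0)}"
    and u: "u1 \<in> emb ` V" "u2 \<in> emb ` V" "u3 \<in> emb ` V" and indep: "fq_indep q u1 u2 u3"
    and iso: "\<And>x y. x \<in> fq_span q u1 u2 u3 \<Longrightarrow> y \<in> fq_span q u1 u2 u3 \<Longrightarrow> herm q \<omega> x y = 0"
    using assms unfolding generators_def sigma_vecs_eq by blast
  obtain w1 w2 w3 where w: "w1 \<in> V" "w2 \<in> V" "w3 \<in> V" and uw: "u1 = emb w1" "u2 = emb w2" "u3 = emb w3"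
    using u by blast
  \<comment> \<open>Parametrising the span by \<open>F^3\<close> pulls the generator back along
    \<open>emb\<close>; independence of the spanning vectors makes the parametrisation
    injective.\<close>
  define comb where "comb = (\<lambda>(a1, a2, a3). scale a1 w1 + scale a2 w2 + scale a3 w3)"
  define W where "W = comb ` (F \<times> F \<times> F)"
  have comb_simp: "comb (a1, a2, a3) = scale a1 w1 + scale a2 w2 + scale a3 w3" for a1 a2 a3
    by (simp add: comb_def)
  have emb_comb: "emb (comb (a1, a2, a3)) = (\<lambda>i. a1 * u1 i + a2 * u2 i + a3 * u3 i)"
    if "a1 \<in> F" "a2 \<in> F" "a3 \<in> F" for a1 a2 a3
    using that by (simp add: comb_simp emb_add emb_scale uw)
  have add_comb: "comb (a1, a2, a3) + comb (b1, b2, b3) = comb (a1 + b1, a2 + b2, a3 + b3)" for a1 a2 a3 b1 b2 b3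
    unfolding comb_simp by (cases w1; cases w2; cases w3) (simp add: algebra_simps)
  have scale_comb: "scale f (comb (a1, a2, a3)) = comb (f * a1, f * a2, f * a3)" for f a1 a2 a3
    unfolding comb_simp by (cases w1; cases w2; cases w3) (simp add: algebra_simps)
  have span: "fq_span q u1 u2 u3 = emb ` W"
  proof (intro equalityI subsetI)
    fix x assume "x \<in> fq_span q u1 u2 u3"
    then obtain a1 a2 a3 where a: "a1 \<in> F" "a2 \<in> F" "a3 \<in> F" "x = (\<lambda>i. a1 * u1 i + a2 * u2 i + a3 * u3 i)"
      unfolding fq_span_def F_def[symmetric] by blast
    then have "x = emb (comb (a1, a2, a3))" using emb_comb by simp
    then show "x \<in> emb ` W" unfolding W_def using a by blast
  next
    fix x assume "x \<in> emb ` W"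
    then obtain a1 a2 a3 where a: "a1 \<in> F" "a2 \<in> F" "a3 \<in> F" "x = emb (comb (a1, a2, a3))"
      unfolding W_def by blast
    then have "x = (\<lambda>i. a1 * u1 i + a2 * u2 i + a3 * u3 i)" using emb_comb by simp
    then show "x \<in> fq_span q u1 u2 u3" unfolding fq_span_def F_def[symmetric] using a by blast
  qed
  have WV: "W \<subseteq> V"
    using w unfolding W_def comb_def by (cases w1; cases w2; cases w3) (auto simp: V_simp)
  have "inj_on comb (F \<times> F \<times> F)"
  proof (rule inj_onI)
    fix a b assume ab: "a \<in> F \<times> F \<times> F" "b \<in> F \<times> F \<times> F" "comb a = comb b"
    obtain a1 a2 a3 where a: "a = (a1, a2, a3)" by (cases a)
    obtain b1 b2 b3 where b: "b = (b1, b2, b3)" by (cases b)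
    have F: "a1 + b1 \<in> F" "a2 + b2 \<in> F" "a3 + b3 \<in> F" using ab by (simp_all add: a b)
    have "comb (a1 + b1, a2 + b2, a3 + b3) = comb a + comb a"
      unfolding add_comb[symmetric] using ab(3) by (simp add: a b)
    also have "\<dots> = 0" by (cases "comb a") (simp add: zero_prod_def)
    finally have "(\<lambda>i. (a1 + b1) * u1 i + (a2 + b2) * u2 i + (a3 + b3) * u3 i) = (\<lambda>i. 0)"
      using emb_comb[OF F] emb_0 by simp
    then have "a1 + b1 = 0 \<and> a2 + b2 = 0 \<and> a3 + b3 = 0"
      using indep F unfolding fq_indep_def F_def[symmetric] by blast
    then show "a = b" by (simp add: a b)
  qed
  then have "card W = q ^ 3"
    by (simp add: W_def card_image card_cartesian_product card_F power3_eq_cube)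
  moreover have "isotropic W"
    unfolding isotropic_def
  proof (intro conjI ballI WV)
    fix x y assume xy: "x \<in> W" "y \<in> W"
    then show "x + y \<in> W" unfolding W_def by (auto simp: add_comb intro!: imageI)
    show "form x y = 0"
      using iso[of "emb x" "emb y"] herm_emb[of x y] xy WV unfolding span by auto
  next
    fix f x assume "f \<in> F" "x \<in> W"
    then show "scale f x \<in> W" unfolding W_def by (auto simp: scale_comb intro!: imageI)
  qed
  moreover have "0 \<in> W"
  proof -
    have "comb (0, 0, 0) = 0" unfolding comb_simp by (cases w1; cases w2; cases w3) (simp add: zero_prod_def)
    then show ?thesis unfolding W_def by (metis F_0 SigmaI imageI)
  qed
  moreover have "g = pt ` (W - {0})"
  proof -
    have "g = {pt w | w. w \<in> W \<and> emb w \<noteq> (\<lambda>i. 0)}" unfolding g span pt_def by blast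
    then show ?thesis unfolding emb_eq_0_iff by blast
  qed
  ultimately show ?thesis using that by blast
qed

text \<open>The \<open>q^2\<close> solutions in \<open>W\<close> include 0; the other
  \<open>q^2 - 1\<close> fall into classes of size \<open>q - 1\<close>.\<close>

lemma card_generator_ovoid:
  assumes "g \<in> generators q \<omega>"
  shows "card (g \<inter> ovoid_O q \<omega> \<gamma>) = q + 1"
proof -
  obtain W where W: "isotropic W" "card W = q ^ 3" "0 \<in> W" and g: "g = pt ` (W - {0})"
    using generator_isotropic[OF assms] .
  let ?X = "{w \<in> W. on_O w} - {0}"
  have WV: "W \<subseteq> V" using W(1) by (simp add: isotropic_def)
  have eq: "g \<inter> ovoid_O q \<omega> \<gamma> = pt ` ?X"
  proof (intro equalityI subsetI)
    fix P assume "P \<in> g \<inter> ovoid_O q \<omega> \<gamma>"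
    then obtain w w' where w: "w \<in> W" "w \<noteq> 0" "P = pt w" and w': "w' \<in> V" "w' \<noteq> 0" "on_O w'" "P = pt w'"
      unfolding g ovoid_O_eq by blast
    \<comment> \<open>The plane and the ovoid may supply different representatives of the same
      point; \<open>on_O\<close> passes between them by scaling.\<close>
    obtain f where "f \<in> F" "w = scale f w'" using pt_eq_iff[of w' w] w w' WV by auto
    then have "on_O w" using on_O_scale w'(3) by simp
    then show "P \<in> pt ` ?X" using w by auto
  next
    fix P assume "P \<in> pt ` ?X"
    then show "P \<in> g \<inter> ovoid_O q \<omega> \<gamma>" unfolding g ovoid_O_eq using WV by auto
  qed
  have "card (pt ` ?X) * (q - 1) = card ?X"
    by (rule card_pt_image) (use WV in \<open>auto simp: isotropic_scale[OF W(1)] on_O_scale scale_eq_0_iff\<close>)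
  also have "card ?X = q\<^sup>2 - 1"
  proof -
    have "on_O 0" by (simp add: zero_prod_def on_O_simp exI[of _ 0])
    then show ?thesis using card_on_O_isotropic[OF W(1,2)] W(3) by (subst card_Diff_singleton) auto
  qed
  also have "q\<^sup>2 - 1 = (q + 1) * (q - 1)" by (simp add: power2_eq_square algebra_simps)
  finally have "card (pt ` ?X) * (q - 1) = (q + 1) * (q - 1)" .
  moreover have "q - 1 \<noteq> 0" using q_gt_1 by simp
  ultimately have "card (pt ` ?X) = q + 1" by (rule mult_right_cancel[THEN iffD1, rotated])
  then show ?thesis unfolding eq .
qed

text \<open>For \<open>d = 0\<close> the pair \<open>(A, B)\<close> is free and fixes
  \<open>C\<close>, hence \<open>s\<close>. For \<open>d \<noteq> 0\<close> irreducibility gives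
  \<open>A \<noteq> 0\<close>, and \<open>(A, C, d)\<close> is free and determines \<open>B\<close>
  and \<open>s\<close>.\<close>

lemma card_on_O: "card {w \<in> V. on_O w} = q ^ 4 + (q\<^sup>2 - 1) * (q\<^sup>2 * (q - 1))"
proof -
  define rt where "rt x = (SOME y. y\<^sup>2 = x)" for x :: 'a
  have rt: "(rt x)\<^sup>2 = x" for x unfolding rt_def by (rule someI_ex) (rule square_root_exists)
  let ?f = "\<lambda>(A, B). (A, B, tr (\<mu> * rt (A * B)), 0)"
  let ?h = "\<lambda>(A, C, d). (A, (C\<^sup>2 + d * C + d\<^sup>2 * \<gamma>) / A, tr (\<mu> * C), d)"
  let ?X = "(UNIV - {0}) \<times> UNIV \<times> (F - {0})"
  have "inj ?f" by (auto simp: inj_on_def)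
  then have "card (range ?f) = card (UNIV :: ('a \<times> 'a) set)" by (rule card_image)
  then have card_f: "card (range ?f) = q ^ 4"
    by (simp add: card_cartesian_product card_field flip: UNIV_Times_UNIV power_add)
  have "inj_on ?h ?X"
  proof (rule inj_onI)
    fix x y assume xy: "x \<in> ?X" "y \<in> ?X" "?h x = ?h y"
    obtain A C d where x: "x = (A, C, d)" by (cases x)
    obtain C' where y: "y = (A, C', d)" using xy(3) by (cases y) (simp add: x)
    have A: "A \<noteq> 0" and d: "d \<in> F" "d \<noteq> 0" using xy(1) by (simp_all add: x)
    have eq: "(C\<^sup>2 + d * C + d\<^sup>2 * \<gamma>) / A = (C'\<^sup>2 + d * C' + d\<^sup>2 * \<gamma>) / A" "tr (\<mu> * C) = tr (\<mu> * C')"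
      using xy(3) unfolding x y prod.case prod.inject by blast+
    have "(C + C') * (C + C' + d) = (C\<^sup>2 + d * C + d\<^sup>2 * \<gamma>) + (C'\<^sup>2 + d * C' + d\<^sup>2 * \<gamma>)"
      by (simp add: power2_eq_square algebra_simps)
    also have "\<dots> = 0" using eq(1) A unfolding divide_cancel_right add_eq_0_char2 by blast
    finally have "C + C' = 0 \<or> C + C' = d" by (simp only: mult_eq_0_iff add_eq_0_char2)
    \<comment> \<open>The quadratic in \<open>C\<close> has a second root \<open>C + d\<close>, but
      it gives another trace: the weighted trace of a nonzero \<open>d\<close> in \<open>F\<close>
      is \<open>d * \<mu> * \<nu>\<close>.\<close>
    moreover have "C + C' \<noteq> d"
    proof
      assume "C + C' = d"
      then have "tr (\<mu> * d) = 0" using eq(2) by (auto simp: distrib_left tr_add)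
      then show False using tr_scale[OF d(1), of \<mu>] d(2) by (simp add: tr_mu mult.commute)
    qed
    ultimately show "x = y" by (simp add: x y)
  qed
  then have card_h: "card (?h ` ?X) = (q\<^sup>2 - 1) * (q\<^sup>2 * (q - 1))"
    by (simp add: card_image card_cartesian_product card_field card_F)
  have "{w \<in> V. on_O w} = range ?f \<union> ?h ` ?X"
  proof (intro equalityI subsetI)
    fix w assume w: "w \<in> {w \<in> V. on_O w}"
    obtain A B s d where wd: "w = (A, B, s, d)" by (cases w)
    have d: "d \<in> F" using w by (simp add: wd V_simp)
    obtain C where C: "A * B = C\<^sup>2 + d * C + d\<^sup>2 * \<gamma>" "s = tr (\<mu> * C)"
      using w by (auto simp: wd on_O_simp)
    show "w \<in> range ?f \<union> ?h ` ?X"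
    proof (cases "d = 0")
      case True
      then have "C = rt (A * B)" using C(1) rt[of "A * B"] by (simp add: square_inj)
      then have "w = ?f (A, B)" using C(2) True by (simp add: wd)
      then show ?thesis by blast
    next
      case False
      have "A \<noteq> 0"
      proof
        assume "A = 0"
        then have "d\<^sup>2 * ((C / d)\<^sup>2 + C / d + \<gamma>) = 0"
          using C(1) False by (simp add: field_simps power2_eq_square)
        then show False using False no_root by simp
      qed
      then have "w = ?h (A, C, d)" using C by (simp add: wd flip: C(1))
      moreover have "(A, C, d) \<in> ?X" using False d \<open>A \<noteq> 0\<close> by simp
      ultimately show ?thesis by blast
    qed
  next
    fix w assume "w \<in> range ?f \<union> ?h ` ?X"
    then show "w \<in> {w \<in> V. on_O w}"
    proof (elim UnE imageE)
      fix x assume x: "w = ?f x"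
      obtain A B where "x = (A, B)" by (cases x)
      then show ?thesis by (auto simp: x V_simp on_O_simp rt intro!: exI[of _ "rt (A * B)"])
    next
      fix x assume x: "w = ?h x" "x \<in> ?X"
      obtain A C d where "x = (A, C, d)" by (cases x)
      then show ?thesis using x(2) by (auto simp: x(1) V_simp on_O_simp)
    qed
  qed
  moreover have "range ?f \<inter> ?h ` ?X = {}" by auto
  ultimately show ?thesis using card_f card_h by (simp add: card_Un_disjoint)
qed

lemma card_ovoid: "card (ovoid_O q \<omega> \<gamma>) = (q + 1) * (q ^ 3 + 1)"
proof -
  let ?X = "{w \<in> V. on_O w} - {0}"
  have "on_O 0" "0 \<in> V" by (simp_all add: zero_prod_def on_O_simp exI[of _ 0] V_simp)
  then have card_X: "card ?X = q ^ 4 + (q\<^sup>2 - 1) * (q\<^sup>2 * (q - 1)) - 1"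
    by (subst card_Diff_singleton) (simp_all add: card_on_O)
  have "card (pt ` ?X) * (q - 1) = card ?X"
    by (rule card_pt_image) (auto simp: V_scale on_O_scale scale_eq_0_iff)
  also have "\<dots> = (q + 1) * (q ^ 3 + 1) * (q - 1)"
  proof -
    \<comment> \<open>Substituting \<open>Suc k\<close> for \<open>q\<close> removes the truncated
      subtractions before the polynomial identity is checked.\<close>
    obtain k where "q = Suc k" using q_pos gr0_implies_Suc by blast
    then show ?thesis unfolding card_X by (simp add: algebra_simps power2_eq_square power3_eq_cube power4_eq_xxxx)
  qed
  finally have "card (pt ` ?X) * (q - 1) = (q + 1) * (q ^ 3 + 1) * (q - 1)" .
  moreover have "q - 1 \<noteq> 0" using q_gt_1 by simp
  ultimately have "card (pt ` ?X) = (q + 1) * (q ^ 3 + 1)" by (rule mult_right_cancel[THEN iffD1, rotated])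
  moreover have "ovoid_O q \<omega> \<gamma> = pt ` ?X" unfolding ovoid_O_eq by (rule arg_cong[of _ _ "image pt"]) blast
  ultimately show ?thesis by simp
qed

end

theorem mainTheorem18:
  fixes q e :: nat and \<omega> \<gamma> :: "'a::{field,finite}"
  assumes "e \<ge> 1" and "q = 2 ^ e"
    and "card (UNIV :: 'a set) = q\<^sup>2"
    and "\<omega> \<notin> subF q" and "\<omega> + \<omega> ^ q = 1"
    and "irreducible [:\<gamma>, 1, 1:]"
  shows "is_m_ovoid q \<omega> (ovoid_O q \<omega> \<gamma>) (q + 1)
       \<and> card (ovoid_O q \<omega> \<gamma>) = (q + 1) * (q ^ 3 + 1)"
proof -
  interpret char2_quadratic q e \<omega> \<gamma>
    using assms irreducible_quadratic_no_root by unfold_locales auto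
  have "ovoid_O q \<omega> \<gamma> \<subseteq> Sigma_pts q"
    unfolding ovoid_O_eq Sigma_pts_eq by blast
  then show ?thesis
    unfolding is_m_ovoid_def using card_generator_ovoid card_ovoid by blast
qed

end
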